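(* Consider the linear constant-coefficient system $u'(t)=Lu(t)+g(t)=\sum_{k=1}^r F_k(t,u(t))$, $u(0)=u_0$, in $\mathbb{R}^m$, with $F_k(t,v)=L_kv+g_k(t)$, $L=\sum_k L_k$, $g=\sum_k g_k$, and let $u_n\approx u(t_n)$, $t_n=n\Delta t$, be computed by the $s$-stage partitioned Runge-Kutta method with coefficients $A_k=[a^{(k)}_{ij}]$, $b_k=[b^{(k)}_i]$ ($1\le k\le r$), $c=[c_i]$ (see context). Let $\varepsilon_n=u(t_n)-u_n$ be the global error, let $Z_k=\Delta t\,L_k$ and $\underline{Z}=(Z_1,\dots,Z_r)$, and let $R(\underline{Z})$, $\boldsymbol{r}(\underline{Z})^T=[r_1(\underline{Z}),\dots,r_s(\underline{Z})]$ be as defined in the context. Let $l\ge 1$. Suppose that the functions $\varphi_k(t)=F_k(t,u(t))$, $1\le k\le r$, are $l$ times continuously differentiable, and that $\|r_j(\underline{Z})\|\le M$ for $j=1,\dots,s$ with a fixed $M>0$. Then the global errors satisfy the recursion $$\varepsilon_{n+1}=R(\underline{Z})\,\varepsilon_n+\delta_n,\qquad n\ge 0,$$ where the local error $\delta_n$ is given by $$\delta_n=\sum_{j=1}^{l}\frac{\Delta t^j}{j!}\sum_{k=1}^{r}d_{j,k}(\underline{Z})\,\varphi_k^{(j-1)}(t_n)+\mathcal{O}(\Delta t^{l+1})\max_{k,t}\|\varphi_k^{(l)}(t)\|,$$ with $$d_{j,k}(\underline{Z})=\big(I-j\,\boldsymbol{b}_k^T\boldsymbol{c}^{j-1}\big)+\boldsymbol{r}(\underline{Z})^T\big(\boldsymbol{c}^j-j\,\boldsymbol{A}_k\boldsymbol{c}^{j-1}\big).$$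 Here the remainder is a vector whose norm is at most $C\,\Delta t^{l+1}\max_{k,t}\|\varphi_k^{(l)}(t)\|$, with $C$ depending only on $M$, $l$ and the coefficients of the method, and the maximum is over $1\le k\le r$ and over $t$ in the smallest interval containing $t_n$, $t_{n+1}$ and all $t_n+c_i\Delta t$, $1\le i\le s$.
   Context: The partitioned Runge-Kutta method with $s$ stages and time step $\Delta t>0$ is $$v_{n,i}=u_n+\Delta t\sum_{k=1}^r\sum_{j=1}^s a^{(k)}_{ij}F_k(t_n+c_j\Delta t,v_{n,j}),\quad i=1,\dots,s,$$ $$u_{n+1}=u_n+\Delta t\sum_{k=1}^r\sum_{j=1}^s b^{(k)}_jF_k(t_n+c_j\Delta t,v_{n,j}),$$ with $t_n=n\Delta t$, $A_k=[a^{(k)}_{ij}]\in\mathbb{R}^{s\times s}$, $b_k=[b^{(k)}_i]\in\mathbb{R}^s$, and abscissae $c=[c_i]=A_re$, where $e=[1,\dots,1]^T\in\mathbb{R}^s$. The exact solution $u$ is defined on a time interval containing all time points involved. Componentwise powers: $c^j=[c_i^{\,j}]$ for $j\ge1$, $c^0=e$. Kronecker products with the $m\times m$ identity $I$: $\boldsymbol{A}_k=A_k\otimes I$, $\boldsymbol{b}_k^T=b_k^T\otimes I$, $\boldsymbol{c}^j=c^j\otimes I$, $\boldsymbol{e}=e\otimes I$. Also $\boldsymbol{Z}_k=I_{s\times s}\otimes Z_k$, and $\boldsymbol{I}$ is the $ms\times ms$ identity. Define $$\boldsymbol{r}(\underline{Z})^T=[r_1(\underline{Z}),\dots,r_s(\underline{Z})]=\Big(\sum_{k=1}^r\boldsymbol{b}_k^T\boldsymbol{Z}_k\Big)\Big(\boldsymbol{I}-\sum_{k=1}^r\boldsymbol{A}_k\boldsymbol{Z}_k\Big)^{-1}\in\mathbb{R}^{m\times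 ms},$$ with blocks $r_j(\underline{Z})\in\mathbb{R}^{m\times m}$, and $$R(\underline{Z})=I+\boldsymbol{r}(\underline{Z})^T\boldsymbol{e}\in\mathbb{R}^{m\times m}.$$ The inverse is assumed to exist (this is automatic for explicit methods, where $a^{(k)}_{ij}=0$ for $j\ge i$). $\|\cdot\|$ is a norm on $\mathbb{R}^m$ together with its induced matrix norm. *)

theory Defs
  imports Complex_Main "Jordan_Normal_Form.Gauss_Jordan_Elimination"
begin

text \<open>
  The constant in the error bound must not depend on the dimension \<open>m\<close> of the system, so
  vectors and matrices are those of \<^theory>\<open>Jordan_Normal_Form.Matrix\<close>, whose sizes are numbers.
  Stages and components are numbered from \<open>0\<close>; the parts \<open>F k\<close> of the splitting
  are numbered \<open>k = 1, ..., r\<close>, so that the index \<open>r\<close> in \<open>c = A r e\<close> is the last one.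
\<close>

abbreviation vsum :: "nat \<Rightarrow> ('k \<Rightarrow> real vec) \<Rightarrow> 'k set \<Rightarrow> real vec" where
  "vsum m \<equiv> finsum_vec TYPE(real) m"

abbreviation msum :: "nat \<Rightarrow> nat \<Rightarrow> ('k \<Rightarrow> real mat) \<Rightarrow> 'k set \<Rightarrow> real mat" where
  "msum p q \<equiv> finsum (module_mat TYPE(real) p q)"

subsection \<open>Norms and derivatives on \<open>m\<close>-dimensional vectors\<close>

definition is_vec_norm :: "nat \<Rightarrow> (real vec \<Rightarrow> real) \<Rightarrow> bool" where
  "is_vec_norm m nrm \<longleftrightarrow>
     (\<forall>x\<in>carrier_vec m. 0 \<le> nrm x \<and> (nrm x = 0 \<longleftrightarrow> x = 0\<^sub>v m)) \<and>
     (\<forall>a. \<forall>x\<in>carrier_vec m. nrm (a \<cdot>\<^sub>v x) = \<bar>a\<bar> * nrm x) \<and>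
     (\<forall>x\<in>carrier_vec m. \<forall>y\<in>carrier_vec m. nrm (x + y) \<le> nrm x + nrm y)"

definition induced_norm :: "nat \<Rightarrow> (real vec \<Rightarrow> real) \<Rightarrow> real mat \<Rightarrow> real" where
  "induced_norm m nrm B = Sup {nrm (B *\<^sub>v x) | x. x \<in> carrier_vec m \<and> nrm x = 1}"

definition has_vec_deriv ::
    "nat \<Rightarrow> (real \<Rightarrow> real vec) \<Rightarrow> real vec \<Rightarrow> real filter \<Rightarrow> bool" where
  "has_vec_deriv m f f' Fl \<longleftrightarrow> (\<forall>i<m. ((\<lambda>t. f t $ i) has_field_derivative f' $ i) Fl)"

text \<open>
  \<open>f\<close> is \<open>l\<close> times continuously differentiable on \<open>T\<close>, with \<open>D j\<close> its \<open>j\<close>-th derivative.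
  Derivatives are taken within \<open>T\<close>, hence are one-sided at end points; if \<open>T\<close> is an
  interval with more than one point, they determine \<open>D j\<close> on \<open>T\<close>.
\<close>

definition C_with_derivs ::
    "nat \<Rightarrow> nat \<Rightarrow> real set \<Rightarrow> (real \<Rightarrow> real vec) \<Rightarrow> (nat \<Rightarrow> real \<Rightarrow> real vec) \<Rightarrow> bool" where
  "C_with_derivs m l T f D \<longleftrightarrow>
     (\<forall>j\<le>l. \<forall>t\<in>T. D j t \<in> carrier_vec m) \<and>
     (\<forall>t\<in>T. D 0 t = f t) \<and>
     (\<forall>j<l. \<forall>t\<in>T. has_vec_deriv m (D j) (D (Suc j) t) (at t within T)) \<and>
     (\<forall>i<m. continuous_on T (\<lambda>t. D l t $ i))"

subsection \<open>The partitioned Runge-Kutta method\<close>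

definition split_rhs ::
    "(nat \<Rightarrow> real mat) \<Rightarrow> (nat \<Rightarrow> real \<Rightarrow> real vec) \<Rightarrow> nat \<Rightarrow> real \<Rightarrow> real vec \<Rightarrow> real vec" where
  "split_rhs L g k t x = L k *\<^sub>v x + g k t"

definition abscissae :: "nat \<Rightarrow> nat \<Rightarrow> (nat \<Rightarrow> real mat) \<Rightarrow> real vec" where
  "abscissae r s A = A r *\<^sub>v vec s (\<lambda>_. 1)"

text \<open>
  \<open>y\<close> results from \<open>x\<close> by one step of length \<open>h\<close> starting at time \<open>t\<close>, with stage values
  \<open>V 0, ..., V (s - 1)\<close>.
\<close>

definition prk_step ::
    "nat \<Rightarrow> nat \<Rightarrow> nat \<Rightarrow> (nat \<Rightarrow> real mat) \<Rightarrow> (nat \<Rightarrow> real vec) \<Rightarrow>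
     (nat \<Rightarrow> real \<Rightarrow> real vec \<Rightarrow> real vec) \<Rightarrow> real \<Rightarrow> real \<Rightarrow>
     real vec \<Rightarrow> (nat \<Rightarrow> real vec) \<Rightarrow> real vec \<Rightarrow> bool" where
  "prk_step m r s A b F h t x V y \<longleftrightarrow>
     x \<in> carrier_vec m \<and> y \<in> carrier_vec m \<and> (\<forall>i<s. V i \<in> carrier_vec m) \<and>
     (\<forall>i<s. V i = x + h \<cdot>\<^sub>v vsum m (\<lambda>k. vsum m (\<lambda>j.
        (A k $$ (i, j)) \<cdot>\<^sub>v F k (t + abscissae r s A $ j * h) (V j)) {..<s}) {1..r}) \<and>
     y = x + h \<cdot>\<^sub>v vsum m (\<lambda>k. vsum m (\<lambda>j.
        (b k $ j) \<cdot>\<^sub>v F k (t + abscissae r s A $ j * h) (V j)) {..<s}) {1..r}"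

definition step_times :: "nat \<Rightarrow> nat \<Rightarrow> (nat \<Rightarrow> real mat) \<Rightarrow> real \<Rightarrow> nat \<Rightarrow> real set" where
  "step_times r s A h n =
     {real n * h, real (Suc n) * h} \<union> (\<lambda>i. real n * h + abscissae r s A $ i * h) ` {..<s}"

definition step_interval :: "nat \<Rightarrow> nat \<Rightarrow> (nat \<Rightarrow> real mat) \<Rightarrow> real \<Rightarrow> nat \<Rightarrow> real set" where
  "step_interval r s A h n = {Min (step_times r s A h n)..Max (step_times r s A h n)}"

subsection \<open>Kronecker products and the matrix functions of the method\<close>

definition kron :: "real mat \<Rightarrow> real mat \<Rightarrow> real mat" where
  "kron P Q = mat (dim_row P * dim_row Q) (dim_col P * dim_col Q)
     (\<lambda>(i, j). P $$ (i div dim_row Q, j div dim_col Q) * Q $$ (i mod dim_row Q, j mod dim_col Q))"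

definition bold_A :: "nat \<Rightarrow> (nat \<Rightarrow> real mat) \<Rightarrow> nat \<Rightarrow> real mat" where
  "bold_A m A k = kron (A k) (1\<^sub>m m)"

definition bold_bT :: "nat \<Rightarrow> (nat \<Rightarrow> real vec) \<Rightarrow> nat \<Rightarrow> real mat" where
  "bold_bT m b k = kron (mat_of_row (b k)) (1\<^sub>m m)"

definition bold_e :: "nat \<Rightarrow> nat \<Rightarrow> real mat" where
  "bold_e m s = kron (mat s 1 (\<lambda>_. 1)) (1\<^sub>m m)"

text \<open>For \<open>j = 0\<close> this agrees with \<^const>\<open>bold_e\<close>, because \<open>0 ^ 0 = 1\<close>.\<close>

definition bold_c_pow :: "nat \<Rightarrow> nat \<Rightarrow> nat \<Rightarrow> (nat \<Rightarrow> real mat) \<Rightarrow> nat \<Rightarrow> real mat" where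
  "bold_c_pow m r s A j = kron (mat s 1 (\<lambda>(i, _). (abscissae r s A $ i) ^ j)) (1\<^sub>m m)"

definition bold_Z :: "nat \<Rightarrow> (nat \<Rightarrow> real mat) \<Rightarrow> nat \<Rightarrow> real mat" where
  "bold_Z s Z k = kron (1\<^sub>m s) (Z k)"

definition stage_matrix ::
    "nat \<Rightarrow> nat \<Rightarrow> nat \<Rightarrow> (nat \<Rightarrow> real mat) \<Rightarrow> (nat \<Rightarrow> real mat) \<Rightarrow> real mat" where
  "stage_matrix m r s A Z =
     1\<^sub>m (s * m) - msum (s * m) (s * m) (\<lambda>k. bold_A m A k * bold_Z s Z k) {1..r}"

text \<open>Meaningful only if \<^const>\<open>stage_matrix\<close> is invertible.\<close>

definition rT ::
    "nat \<Rightarrow> nat \<Rightarrow> nat \<Rightarrow> (nat \<Rightarrow> real mat) \<Rightarrow> (nat \<Rightarrow> real vec) \<Rightarrow> (nat \<Rightarrow> real mat) \<Rightarrow> real mat" where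
  "rT m r s A b Z =
     msum m (s * m) (\<lambda>k. bold_bT m b k * bold_Z s Z k) {1..r} *
     the (mat_inverse (stage_matrix m r s A Z))"

definition r_block ::
    "nat \<Rightarrow> nat \<Rightarrow> nat \<Rightarrow> (nat \<Rightarrow> real mat) \<Rightarrow> (nat \<Rightarrow> real vec) \<Rightarrow> (nat \<Rightarrow> real mat) \<Rightarrow> nat \<Rightarrow> real mat" where
  "r_block m r s A b Z j = mat m m (\<lambda>(p, q). rT m r s A b Z $$ (p, j * m + q))"

definition R_mat ::
    "nat \<Rightarrow> nat \<Rightarrow> nat \<Rightarrow> (nat \<Rightarrow> real mat) \<Rightarrow> (nat \<Rightarrow> real vec) \<Rightarrow> (nat \<Rightarrow> real mat) \<Rightarrow> real mat" where
  "R_mat m r s A b Z = 1\<^sub>m m + rT m r s A b Z * bold_e m s"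

definition d_coeff ::
    "nat \<Rightarrow> nat \<Rightarrow> nat \<Rightarrow> (nat \<Rightarrow> real mat) \<Rightarrow> (nat \<Rightarrow> real vec) \<Rightarrow> (nat \<Rightarrow> real mat) \<Rightarrow>
     nat \<Rightarrow> nat \<Rightarrow> real mat" where
  "d_coeff m r s A b Z j k =
     (1\<^sub>m m - real j \<cdot>\<^sub>m (bold_bT m b k * bold_c_pow m r s A (j - 1))) +
     rT m r s A b Z *
       (bold_c_pow m r s A j - real j \<cdot>\<^sub>m (bold_A m A k * bold_c_pow m r s A (j - 1)))"

end

theory Submission
  imports Defs
begin

text \<open>
  Inserting the exact solution into the scheme leaves a defect in every stage and in the update.
  The stage errors solve a linear system whose matrix is the stage matrix; eliminating them gives the
  recursion, and \<open>\<delta>\<close> is the update defect plus \<open>r\<^sup>T\<close> applied to the stage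
  defects. Taylor expansion of \<open>u\<close> (to order \<open>l + 1\<close>) and of the \<open>\<phi>\<^sub>k\<close> (to order \<open>l\<close>)
  in the defects produces the coefficients \<open>d\<^sub>j\<^sub>k\<close> and a remainder. The Taylor remainder is bounded
  by a mean value inequality that holds for an arbitrary norm without any loss, so the constant does
  not depend on the dimension or the norm.
\<close>

section \<open>Taylor's formula for a norm on coordinate vectors\<close>

text \<open>The constant may depend neither on \<open>m\<close> nor on the norm nor on the matrices
  \<open>L k\<close>, and this shapes every estimate. Scalar mean value theorems applied coordinate
  by coordinate would cost factors tied to \<open>m\<close> and \<open>nrm\<close>, and a bound on
  the inverse of the stage matrix would bring in the \<open>L k\<close>. Hence the Taylor bounds
  rest on the seminorm laws alone, and apart from the \<open>\<phi>\<close> themselves the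
  \<open>L k\<close> reach the remainder bound only through the blocks of \<open>rT\<close>, each
  bounded by \<open>M\<close>. Equivalence of norms does occur, but only to know that the supremum
  in \<open>induced_norm\<close> is that of a bounded set; its constant never reaches the estimate.
  The derivative of \<open>u\<close> is the sum of the \<open>r\<close> functions
  \<open>\<phi> k 0\<close>, so \<open>u\<close> has one derivative more than they have, and its
  derivative of order \<open>l + 1\<close> is at most \<open>r\<close> times the supremum. The
  remainders of the \<open>\<phi> k 0\<close> are only of order \<open>h ^ l\<close>, and the factor
  \<open>h\<close> of the scheme supplies the missing power. No order conditions are assumed, so no
  low-order terms cancel: all of them are collected in \<open>d_coeff\<close>.\<close>

lemma has_field_derivative_power_Suc_div_fact:
  fixes f :: "real \<Rightarrow> real"
  assumes "(f has_field_derivative f') (at y within B)"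
  shows "((\<lambda>y. f y ^ Suc q / fact (Suc q) * c) has_field_derivative f' * (f y ^ q / fact q * c))
    (at y within B)"
  using DERIV_cmult_right[OF DERIV_cdivide[OF DERIV_power_Suc[OF assms, of q], of "fact (Suc q)"], of c]
  by (simp add: mult_ac del: power_Suc of_nat_Suc flip: of_nat_Suc)

text \<open>Vectors are plain functions here, so that sums, differences and derivatives can be
  written pointwise without carrier conditions; \<open>coord_cong\<close> says that only the first
  \<open>m\<close> values count. The intended instance is
  \<open>\<lambda>x. nrm (vec m x)\<close>.\<close>

locale coord_seminorm =
  fixes m :: nat and p :: "(nat \<Rightarrow> real) \<Rightarrow> real"
  assumes coord_cong: "(\<And>i. i < m \<Longrightarrow> x i = y i) \<Longrightarrow> p x = p y"
    and triangle: "p (\<lambda>i. x i + y i) \<le> p x + p y"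
    and scale: "p (\<lambda>i. a * x i) = \<bar>a\<bar> * p x"
begin

lemma zero: "p (\<lambda>_. 0) = 0"
  using scale[of 0 "\<lambda>_. 0"] by simp

lemma uminus: "p (\<lambda>i. - x i) = p x"
  using scale[of "-1" x] by simp

lemma nonneg: "0 \<le> p x"
  using triangle[of x "\<lambda>i. - x i"] by (simp add: zero uminus)

lemma triangle_diff: "p (\<lambda>i. x i - y i) \<le> p x + p y"
  using triangle[of x "\<lambda>i. - y i"] by (simp add: uminus)

lemma sum_le: "p (\<lambda>i. \<Sum>k\<in>K. x k i) \<le> (\<Sum>k\<in>K. p (x k))"
proof (induction K rule: infinite_finite_induct)
  case (insert k K)
  then show ?case
    using triangle[of "x k" "\<lambda>i. \<Sum>k\<in>K. x k i"] by simp
qed (simp_all add: zero)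

definition unit :: "nat \<Rightarrow> nat \<Rightarrow> real" where
  "unit j i = (if i = j then 1 else 0)"

lemma le_coords: "p x \<le> (\<Sum>j<m. \<bar>x j\<bar> * p (unit j))"
proof -
  have "p x = p (\<lambda>i. \<Sum>j<m. x j * unit j i)"
    by (rule coord_cong) (simp add: unit_def if_distrib[where f = "\<lambda>a. _ * a"] cong: if_cong)
  also have "\<dots> \<le> (\<Sum>j<m. p (\<lambda>i. x j * unit j i))"
    by (rule sum_le)
  finally show ?thesis
    by (simp add: scale)
qed

text \<open>With a small extra slope \<open>\<eta>\<close> the estimate passes from two adjacent
  intervals to their union, and differentiability at a point gives it on all short intervals around
  that point; bisection (\<open>Bolzano\<close>) then reaches the whole interval. Since only
  seminorm laws act on the vector values, no factor is lost.\<close>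

lemma mean_value_inequality:
  assumes "a \<le> b"
    and f: "\<And>i t. i < m \<Longrightarrow> t \<in> {a..b} \<Longrightarrow>
      ((\<lambda>t. f t i) has_field_derivative f' t i) (at t within {a..b})"
    and G: "\<And>t. t \<in> {a..b} \<Longrightarrow> (G has_field_derivative G' t) (at t within {a..b})"
    and le: "\<And>t. t \<in> {a..b} \<Longrightarrow> p (f' t) \<le> G' t"
  shows "p (\<lambda>i. f b i - f a i) \<le> G b - G a"
proof (rule field_le_epsilon)
  fix e :: real assume "0 < e"
  \<comment> \<open>The accumulated slack \<open>\<eta> * (b - a)\<close> stays below
    \<open>e\<close>; the summand 1 covers the case \<open>a = b\<close>.\<close>
  define \<eta> where "\<eta> = e / (b - a + 1)"
  have \<eta>: "0 < \<eta>" using \<open>0 < e\<close> \<open>a \<le> b\<close> by (simp add: \<eta>_def)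
  define Q where "Q x y \<longleftrightarrow> (x \<in> {a..b} \<longrightarrow> y \<in> {a..b} \<longrightarrow>
    p (\<lambda>i. f y i - f x i) \<le> G y - G x + \<eta> * (y - x))" for x y
  have "Q a b"
    using \<open>a \<le> b\<close>
  proof (induction rule: Bolzano)
    case (trans x y z)
    show ?case
      unfolding Q_def
    proof (intro impI)
      assume xz: "x \<in> {a..b}" "z \<in> {a..b}"
      have "p (\<lambda>i. f z i - f x i) \<le> p (\<lambda>i. f z i - f y i) + p (\<lambda>i. f y i - f x i)"
        using triangle[of "\<lambda>i. f z i - f y i" "\<lambda>i. f y i - f x i"] by simp
      also have "\<dots> \<le> (G z - G y + \<eta> * (z - y)) + (G y - G x + \<eta> * (y - x))"
        using trans xz by (intro add_mono) (auto simp: Q_def)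
      finally show "p (\<lambda>i. f z i - f x i) \<le> G z - G x + \<eta> * (z - x)"
        by (simp add: algebra_simps)
    qed
  next
    case (local x)
    then have x: "x \<in> {a..b}" by simp
    \<comment> \<open>\<open>\<kappa>\<close> is the accuracy demanded of each single coordinate.
      The dimension-dependent sum of the \<open>p (unit j)\<close> does no harm, because it is
      divided out before the radius is chosen; the summand 1 guards against a vanishing sum.\<close>
    define \<kappa> where "\<kappa> = \<eta> / (2 * ((\<Sum>j<m. p (unit j)) + 1))"
    have \<kappa>: "0 < \<kappa>" and \<kappa>_le: "\<kappa> * (\<Sum>j<m. p (unit j)) \<le> \<eta> / 2"
      using \<eta> sum_nonneg[of "{..<m}" "\<lambda>j. p (unit j)"] nonneg
      by (auto simp: \<kappa>_def field_simps add_nonneg_pos)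
    have near: "\<exists>d>0. \<forall>y\<in>{a..b}. \<bar>y - x\<bar> < d \<longrightarrow> \<bar>F y - F x - (y - x) * D\<bar> \<le> k * \<bar>y - x\<bar>"
      if F: "(F has_field_derivative D) (at x within {a..b})" and k: "0 < k" for F :: "real \<Rightarrow> real" and D k
    proof -
      obtain d where "0 < d" and d: "\<And>y. y \<in> {a..b} \<Longrightarrow> y \<noteq> x \<Longrightarrow> \<bar>y - x\<bar> < d \<Longrightarrow>
          \<bar>(F y - F x) / (y - x) - D\<bar> < k"
        using tendstoD[OF F[unfolded has_field_derivative_iff] k]
        unfolding eventually_at dist_real_def by blast
      have "\<bar>F y - F x - (y - x) * D\<bar> \<le> k * \<bar>y - x\<bar>" if "y \<in> {a..b}" "\<bar>y - x\<bar> < d" for y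
      proof (cases "y = x")
        case False
        then have "F y - F x - (y - x) * D = ((F y - F x) / (y - x) - D) * (y - x)"
          by (simp add: field_simps)
        then show ?thesis
          using d[OF that(1) False that(2)] by (simp add: abs_mult mult_right_mono)
      qed simp
      then show ?thesis using \<open>0 < d\<close> by blast
    qed
    \<comment> \<open>Each coordinate has its own radius; induction on the number of coordinates
      takes the least of them.\<close>
    have "\<exists>d>0. \<forall>y\<in>{a..b}. \<bar>y - x\<bar> < d \<longrightarrow> (\<forall>i<n. \<bar>f y i - f x i - (y - x) * f' x i\<bar> \<le> \<kappa> * \<bar>y - x\<bar>)"
      if "n \<le> m" for n
      using that
    proof (induction n)
      case 0
      show ?case by (auto intro: exI[of _ 1])
    next
      case (Suc n)
      then obtain d1 where d1: "0 < d1" "\<forall>y\<in>{a..b}. \<bar>y - x\<bar> < d1 \<longrightarrow>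
          (\<forall>i<n. \<bar>f y i - f x i - (y - x) * f' x i\<bar> \<le> \<kappa> * \<bar>y - x\<bar>)"
        by auto
      obtain d2 where d2: "0 < d2" "\<forall>y\<in>{a..b}. \<bar>y - x\<bar> < d2 \<longrightarrow>
          \<bar>f y n - f x n - (y - x) * f' x n\<bar> \<le> \<kappa> * \<bar>y - x\<bar>"
        using near[OF f[of n x] \<kappa>] Suc.prems x by auto
      show ?case
        using d1 d2 by (intro exI[of _ "min d1 d2"]) (auto simp: less_Suc_eq)
    qed
    from this[OF order_refl] obtain d1 where d1: "0 < d1" "\<And>y i. y \<in> {a..b} \<Longrightarrow> \<bar>y - x\<bar> < d1 \<Longrightarrow>
        i < m \<Longrightarrow> \<bar>f y i - f x i - (y - x) * f' x i\<bar> \<le> \<kappa> * \<bar>y - x\<bar>"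
      by auto
    obtain d2 where d2: "0 < d2" "\<And>y. y \<in> {a..b} \<Longrightarrow> \<bar>y - x\<bar> < d2 \<Longrightarrow>
        \<bar>G y - G x - (y - x) * G' x\<bar> \<le> \<eta> / 2 * \<bar>y - x\<bar>"
      using near[OF G[OF x], of "\<eta> / 2"] \<eta> by auto
    have lin: "p (\<lambda>i. f y i - f x i - (y - x) * f' x i) \<le> \<eta> / 2 * \<bar>y - x\<bar>"
      if "y \<in> {a..b}" "\<bar>y - x\<bar> < d1" for y
    proof -
      have "p (\<lambda>i. f y i - f x i - (y - x) * f' x i) \<le> (\<Sum>j<m. \<kappa> * \<bar>y - x\<bar> * p (unit j))"
        by (rule order_trans[OF le_coords], intro sum_mono mult_right_mono d1 that nonneg) auto
      also have "\<dots> = \<kappa> * (\<Sum>j<m. p (unit j)) * \<bar>y - x\<bar>"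
        by (simp add: sum_distrib_left sum_distrib_right sum_divide_distrib mult_ac)
      also have "\<dots> \<le> \<eta> / 2 * \<bar>y - x\<bar>"
        by (intro mult_right_mono \<kappa>_le) auto
      finally show ?thesis .
    qed
    show ?case
    proof (intro exI[of _ "min d1 d2"] conjI allI impI)
      show "0 < min d1 d2" using d1 d2 by simp
      fix y z assume yz: "y \<le> x \<and> x \<le> z \<and> z - y < min d1 d2"
      show "Q y z"
        unfolding Q_def
      proof (intro impI)
        assume y: "y \<in> {a..b}" and z: "z \<in> {a..b}"
        \<comment> \<open>Both ends are compared with the linearization at \<open>x\<close>. Because
          \<open>y \<le> x \<le> z\<close>, the two errors add up to
          \<open>\<eta> / 2 * (z - y)\<close>; the same amount is left for the linearization of
          \<open>G\<close>.\<close>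
        let ?r = "\<lambda>t i. f t i - f x i - (t - x) * f' x i"
        have "p (\<lambda>i. f z i - f y i) = p (\<lambda>i. (?r z i - ?r y i) + (z - y) * f' x i)"
          by (simp add: algebra_simps)
        also have "\<dots> \<le> (p (?r z) + p (?r y)) + (z - y) * p (f' x)"
          using triangle[of "\<lambda>i. ?r z i - ?r y i" "\<lambda>i. (z - y) * f' x i"]
            triangle_diff[of "?r z" "?r y"] yz by (simp add: scale)
        also have "\<dots> \<le> (\<eta> / 2 * (z - x) + \<eta> / 2 * (x - y)) + (z - y) * G' x"
          using lin[OF z] lin[OF y] le[OF x] yz by (intro add_mono mult_left_mono) auto
        also have "\<dots> \<le> G z - G y + \<eta> * (z - y)"
        proof -
          have "\<bar>G z - G x - (z - x) * G' x\<bar> \<le> \<eta> / 2 * (z - x)"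
            using d2(2)[OF z] yz by simp
          moreover have "\<bar>G y - G x - (y - x) * G' x\<bar> \<le> \<eta> / 2 * (x - y)"
            using d2(2)[OF y] yz by simp
          ultimately show ?thesis
            unfolding abs_le_iff by (simp add: algebra_simps) argo
        qed
        finally show "p (\<lambda>i. f z i - f y i) \<le> G z - G y + \<eta> * (z - y)" .
      qed
    qed
  qed
  then have "p (\<lambda>i. f b i - f a i) \<le> G b - G a + \<eta> * (b - a)"
    using \<open>a \<le> b\<close> by (simp add: Q_def)
  also have "\<eta> * (b - a) \<le> e"
    using \<open>0 < e\<close> \<open>a \<le> b\<close> by (simp add: \<eta>_def field_simps)
  finally show "p (\<lambda>i. f b i - f a i) \<le> G b - G a + e"
    by simp
qed

text \<open>The derivative of a Taylor remainder is the remainder, of order one less, of the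
  derivative. The induction therefore runs over shifted families
  \<open>\<lambda>j. D (Suc j)\<close>, and the mean value inequality integrates the bound once,
  starting from the zero of the remainder at \<open>t\<close>.\<close>

lemma taylor_inequality:
  assumes "t \<in> {\<alpha>..\<beta>}" and "x \<in> {\<alpha>..\<beta>}"
    and "\<And>j i t. j < l \<Longrightarrow> i < m \<Longrightarrow> t \<in> {\<alpha>..\<beta>} \<Longrightarrow>
      ((\<lambda>t. D j t i) has_field_derivative D (Suc j) t i) (at t within {\<alpha>..\<beta>})"
    and "\<And>t. t \<in> {\<alpha>..\<beta>} \<Longrightarrow> p (D l t) \<le> S"
  shows "p (\<lambda>i. D 0 x i - (\<Sum>q<l. (x - t) ^ q / fact q * D q t i)) \<le> \<bar>x - t\<bar> ^ l / fact l * S"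
  using assms
proof (induction l arbitrary: D x)
  case 0
  then show ?case by simp
next
  case (Suc l)
  let ?R = "\<lambda>x i. D 0 x i - (\<Sum>q<Suc l. (x - t) ^ q / fact q * D q t i)"
  let ?R' = "\<lambda>x i. D (Suc 0) x i - (\<Sum>q<l. (x - t) ^ q / fact q * D (Suc q) t i)"
  let ?G = "\<lambda>x. (x - t) ^ Suc l / fact (Suc l) * S"
  have IH: "p (?R' y) \<le> \<bar>y - t\<bar> ^ l / fact l * S" if "y \<in> {\<alpha>..\<beta>}" for y
    by (rule Suc.IH[of y "\<lambda>j. D (Suc j)"]) (use that Suc.prems in auto)
  have R: "((\<lambda>y. ?R y i) has_field_derivative ?R' y i) (at y within B)"
    if "i < m" "y \<in> {\<alpha>..\<beta>}" "B \<subseteq> {\<alpha>..\<beta>}" for y i B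
  proof -
    have "((\<lambda>y. D 0 y i) has_field_derivative D (Suc 0) y i) (at y within B)"
      using Suc.prems(3)[of 0 i y] that by (auto intro: DERIV_subset)
    then have "((\<lambda>y. D 0 y i - (D 0 t i + (\<Sum>q<l. (y - t) ^ Suc q / fact (Suc q) * D (Suc q) t i)))
      has_field_derivative ?R' y i) (at y within B)"
      by (rule DERIV_diff[OF _ DERIV_add[OF DERIV_const DERIV_sum[OF
              has_field_derivative_power_Suc_div_fact[where f' = 1]]], THEN DERIV_cong])
         (auto intro!: derivative_eq_intros)
    then show ?thesis
      by (simp add: sum.lessThan_Suc_shift del: sum.lessThan_Suc)
  qed
  have R_t: "?R t i = 0" for i
    by (simp add: sum.lessThan_Suc_shift del: sum.lessThan_Suc)
  show ?case
  proof (cases "t \<le> x")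
    case True
    have "p (\<lambda>i. ?R x i - ?R t i) \<le> ?G x - ?G t"
    proof (rule mean_value_inequality[OF True])
      fix y assume y: "y \<in> {t..x}"
      then have y': "y \<in> {\<alpha>..\<beta>}" and sub: "{t..x} \<subseteq> {\<alpha>..\<beta>}" using Suc.prems by auto
      show "((\<lambda>y. ?R y i) has_field_derivative ?R' y i) (at y within {t..x})" if "i < m" for i
        by (rule R[OF that y' sub])
      show "(?G has_field_derivative (y - t) ^ l / fact l * S) (at y within {t..x})"
        by (rule has_field_derivative_power_Suc_div_fact[where f' = 1, THEN DERIV_cong])
           (auto intro!: derivative_eq_intros)
      show "p (?R' y) \<le> (y - t) ^ l / fact l * S"
        using IH[OF y'] y by simp
    qed
    then show ?thesis using True unfolding R_t by simp
  next
    case False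
    \<comment> \<open>To the left of \<open>t\<close> the interval runs from \<open>x\<close> up to
      \<open>t\<close>. The minus sign gives \<open>?H\<close> the nonnegative slope factor
      \<open>(t - y) ^ l / fact l\<close>, which agrees with the absolute value in the induction
      hypothesis.\<close>
    let ?H = "\<lambda>y. - ((t - y) ^ Suc l / fact (Suc l) * S)"
    have "p (\<lambda>i. ?R t i - ?R x i) \<le> ?H t - ?H x"
    proof (rule mean_value_inequality)
      show "x \<le> t" using False by simp
      fix y assume y: "y \<in> {x..t}"
      then have y': "y \<in> {\<alpha>..\<beta>}" and sub: "{x..t} \<subseteq> {\<alpha>..\<beta>}" using Suc.prems by auto
      show "((\<lambda>y. ?R y i) has_field_derivative ?R' y i) (at y within {x..t})" if "i < m" for i
        by (rule R[OF that y' sub])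
      show "(?H has_field_derivative (t - y) ^ l / fact l * S) (at y within {x..t})"
        by (rule DERIV_minus[OF has_field_derivative_power_Suc_div_fact[where f' = "-1"], THEN DERIV_cong])
           (auto intro!: derivative_eq_intros)
      show "p (?R' y) \<le> (t - y) ^ l / fact l * S"
        using IH[OF y'] y by simp
    qed
    moreover have "p (\<lambda>i. ?R t i - ?R x i) = p (?R x)"
      by (simp only: R_t diff_0 uminus)
    ultimately have "p (?R x) \<le> ?H t - ?H x" by (simp only:)
    also have "\<dots> = \<bar>x - t\<bar> ^ Suc l / fact (Suc l) * S" using False by simp
    finally show ?thesis .
  qed
qed

text \<open>
  Applied with \<open>c0 = c\<^sub>i\<close> and row \<open>i\<close> of the matrices for stage \<open>i\<close>, and with \<open>c0 = 1\<close> and the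
  weights \<open>b\<close> for the update.
\<close>

lemma taylor_defect_bound:
  assumes "finite K" and "0 < h" and t: "t \<in> {\<alpha>..\<beta>}" and c0: "t + c0 * h \<in> {\<alpha>..\<beta>}"
    and c: "\<And>q. q < s \<Longrightarrow> t + c q * h \<in> {\<alpha>..\<beta>}"
    and u: "\<And>i \<tau>. i < m \<Longrightarrow> \<tau> \<in> {\<alpha>..\<beta>} \<Longrightarrow>
      ((\<lambda>\<tau>. u \<tau> i) has_field_derivative (\<Sum>k\<in>K. D k 0 \<tau> i)) (at \<tau> within {\<alpha>..\<beta>})"
    and D: "\<And>k j i \<tau>. k \<in> K \<Longrightarrow> j < l \<Longrightarrow> i < m \<Longrightarrow> \<tau> \<in> {\<alpha>..\<beta>} \<Longrightarrow>
      ((\<lambda>\<tau>. D k j \<tau> i) has_field_derivative D k (Suc j) \<tau> i) (at \<tau> within {\<alpha>..\<beta>})"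
    and S: "\<And>k \<tau>. k \<in> K \<Longrightarrow> \<tau> \<in> {\<alpha>..\<beta>} \<Longrightarrow> p (D k l \<tau>) \<le> S"
  shows "p (\<lambda>i. u (t + c0 * h) i - u t i - h * (\<Sum>k\<in>K. \<Sum>q<s. a k q * D k 0 (t + c q * h) i)
      - (\<Sum>j=1..l. h ^ j / fact j *
          (\<Sum>k\<in>K. (c0 ^ j - real j * (\<Sum>q<s. a k q * c q ^ (j - 1))) * D k (j - 1) t i)))
    \<le> (real (card K) * \<bar>c0\<bar> ^ (l + 1) / fact (l + 1) + (\<Sum>k\<in>K. \<Sum>q<s. \<bar>a k q\<bar> * \<bar>c q\<bar> ^ l / fact l))
      * h ^ (l + 1) * S"
    (is "p ?lhs \<le> _")
proof -
  \<comment> \<open>The tower of derivatives of \<open>u\<close>: above level 0 it consists of sums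
    of the derivatives of the \<open>D k\<close>, shifted by one. \<open>RU\<close> and
    \<open>RK\<close> are the Taylor remainders of \<open>u\<close> (order \<open>l + 1\<close>) and
    of the \<open>D k 0\<close> (order \<open>l\<close>).\<close>
  define DU where "DU j \<tau> i = (case j of 0 \<Rightarrow> u \<tau> i | Suc j \<Rightarrow> (\<Sum>k\<in>K. D k j \<tau> i))" for j \<tau> i
  define RU where "RU i = u (t + c0 * h) i - (\<Sum>q<Suc l. (c0 * h) ^ q / fact q * DU q t i)" for i
  define RK where "RK k q i = D k 0 (t + c q * h) i - (\<Sum>j<l. (c q * h) ^ j / fact j * D k j t i)" for k q i
  have "((\<lambda>\<tau>. DU j \<tau> i) has_field_derivative DU (Suc j) \<tau> i) (at \<tau> within {\<alpha>..\<beta>})"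
    if "j < Suc l" "i < m" "\<tau> \<in> {\<alpha>..\<beta>}" for j i \<tau>
    using that u D by (cases j) (auto simp: DU_def intro!: DERIV_sum)
  moreover have "p (DU (Suc l) \<tau>) \<le> real (card K) * S" if "\<tau> \<in> {\<alpha>..\<beta>}" for \<tau>
  proof -
    have "p (\<lambda>i. \<Sum>k\<in>K. D k l \<tau> i) \<le> real (card K) * S"
      by (rule order_trans[OF sum_le sum_bounded_above]) (rule S[OF _ that])
    then show ?thesis by (simp add: DU_def[abs_def])
  qed
  ultimately have RU: "p RU \<le> \<bar>c0 * h\<bar> ^ Suc l / fact (Suc l) * (real (card K) * S)"
    using taylor_inequality[OF t c0, of "Suc l" DU "real (card K) * S"]
    by (simp add: RU_def[abs_def] DU_def del: sum.lessThan_Suc power_Suc fact_Suc)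
  have RK: "p (RK k q) \<le> \<bar>c q * h\<bar> ^ l / fact l * S" if "k \<in> K" "q < s" for k q
    using taylor_inequality[OF t c[OF that(2)], of l "D k" S] D S that
    by (simp add: RK_def[abs_def])
  \<comment> \<open>The Taylor polynomials cancel exactly against the subtracted sum. A term
    \<open>h * a * (c * h) ^ j / fact j\<close> of the stage sum has the power
    \<open>h ^ Suc j\<close>, and rewriting \<open>1 / fact j\<close> as
    \<open>Suc j / fact (Suc j)\<close> produces the factor \<open>j\<close> in the coefficient of
    index \<open>j\<close>.\<close>
  have "?lhs i = RU i - (\<Sum>k\<in>K. \<Sum>q<s. (h * a k q) * RK k q i)" for i
  proof -
    define x where "x k j = D k j t i" for k j
    have "(\<Sum>j=1..l. h ^ j / fact j * (\<Sum>k\<in>K. (c0 ^ j - real j * (\<Sum>q<s. a k q * c q ^ (j - 1))) * x k (j - 1)))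
      = (\<Sum>j<l. h ^ Suc j / fact (Suc j) *
          (\<Sum>k\<in>K. (c0 ^ Suc j - real (Suc j) * (\<Sum>q<s. a k q * c q ^ j)) * x k j))"
      by (simp add: sum.atLeast1_atMost_eq del: power_Suc fact_Suc of_nat_Suc)
    also have "\<dots> = (\<Sum>j<l. (c0 * h) ^ Suc j / fact (Suc j) * (\<Sum>k\<in>K. x k j)
        - (\<Sum>k\<in>K. \<Sum>q<s. h * a k q * ((c q * h) ^ j / fact j * x k j)))"
    proof (rule sum.cong[OF refl])
      fix j
      have "real (Suc j) / fact (Suc j) = (1 / fact j :: real)"
        by (simp del: of_nat_Suc)
      then have "h ^ Suc j / fact (Suc j) * (real (Suc j) * y) = h * (h ^ j / fact j * y)" for y :: real
        by (simp del: of_nat_Suc fact_Suc add: field_simps)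
      then show "h ^ Suc j / fact (Suc j) *
          (\<Sum>k\<in>K. (c0 ^ Suc j - real (Suc j) * (\<Sum>q<s. a k q * c q ^ j)) * x k j)
        = (c0 * h) ^ Suc j / fact (Suc j) * (\<Sum>k\<in>K. x k j)
          - (\<Sum>k\<in>K. \<Sum>q<s. h * a k q * ((c q * h) ^ j / fact j * x k j))"
        by (simp del: of_nat_Suc fact_Suc power_Suc add: left_diff_distrib right_diff_distrib
            sum_subtractf mult.assoc power_mult_distrib flip: sum_distrib_left)
          (simp del: of_nat_Suc fact_Suc power_Suc add: sum_distrib_left sum_distrib_right sum_divide_distrib mult_ac)
    qed
    also have "\<dots> = (\<Sum>j<l. (c0 * h) ^ Suc j / fact (Suc j) * (\<Sum>k\<in>K. x k j))
        - (\<Sum>k\<in>K. \<Sum>q<s. h * a k q * (\<Sum>j<l. (c q * h) ^ j / fact j * x k j))"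
      unfolding sum_subtractf sum_distrib_left
      by (subst sum.swap, subst (2) sum.swap, rule refl)
    finally show ?thesis
      by (simp add: RU_def RK_def DU_def sum.lessThan_Suc_shift right_diff_distrib sum_subtractf
          sum_distrib_left sum_divide_distrib mult.assoc x_def del: sum.lessThan_Suc power_Suc fact_Suc)
  qed
  then have "p ?lhs = p (\<lambda>i. RU i - (\<Sum>k\<in>K. \<Sum>q<s. (h * a k q) * RK k q i))"
    by simp
  also have "\<dots> \<le> p RU + (\<Sum>k\<in>K. \<Sum>q<s. p (\<lambda>i. (h * a k q) * RK k q i))"
    by (rule order_trans[OF triangle_diff add_left_mono[OF order_trans[OF sum_le sum_mono[OF sum_le]]]])
  also have "\<dots> \<le> \<bar>c0 * h\<bar> ^ Suc l / fact (Suc l) * (real (card K) * S)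
      + (\<Sum>k\<in>K. \<Sum>q<s. \<bar>h * a k q\<bar> * (\<bar>c q * h\<bar> ^ l / fact l * S))"
    unfolding scale by (intro add_mono RU sum_mono mult_left_mono RK) auto
  also have "\<dots> = (real (card K) * \<bar>c0\<bar> ^ (l + 1) / fact (l + 1)
      + (\<Sum>k\<in>K. \<Sum>q<s. \<bar>a k q\<bar> * \<bar>c q\<bar> ^ l / fact l)) * h ^ (l + 1) * S"
    using \<open>0 < h\<close>
    by (simp del: fact_Suc add: distrib_left sum_distrib_left abs_mult power_mult_distrib mult_ac)
  finally show ?thesis .
qed

end

section \<open>Coordinates are bounded by a multiple of the norm\<close>

locale coord_norm = coord_seminorm +
  assumes definite: "p x = 0 \<Longrightarrow> i < m \<Longrightarrow> x i = 0"
begin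

text \<open>
  Induction on the number \<open>k\<close> of nonzero coordinates: the span of the first \<open>k\<close> units is complete,
  so the next unit has positive distance from it.
\<close>

lemma coords_le_aux:
  assumes "k \<le> m"
  shows "\<exists>c\<ge>0. \<forall>x. (\<forall>i. k \<le> i \<longrightarrow> x i = 0) \<longrightarrow> (\<forall>i. \<bar>x i\<bar> \<le> c * p x)"
  using assms
proof (induction k)
  case 0
  show ?case by (intro exI[of _ 0]) auto
next
  case (Suc k)
  then obtain c where "0 \<le> c"
    and c: "\<And>x i. (\<And>i. k \<le> i \<Longrightarrow> x i = 0) \<Longrightarrow> \<bar>x i\<bar> \<le> c * p x"
    by auto
  \<comment> \<open>\<open>d\<close> is a lower bound for the distance of \<open>unit k\<close> from
    the span of the earlier units. If there were none, some sequence \<open>Y\<close> in that span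
    would approach \<open>- unit k\<close>.\<close>
  have "\<exists>d>0. \<forall>y. (\<forall>i. k \<le> i \<longrightarrow> y i = 0) \<longrightarrow> d \<le> p (\<lambda>i. unit k i + y i)"
  proof (rule ccontr)
    assume neg: "\<not> ?thesis"
    have "\<exists>y. (\<forall>i. k \<le> i \<longrightarrow> y i = 0) \<and> p (\<lambda>i. unit k i + y i) < inverse (real (Suc n))" for n
    proof -
      have "0 < inverse (real (Suc n))" by simp
      then show ?thesis using neg by (meson not_le)
    qed
    then obtain Y where Y0: "\<And>n i. k \<le> i \<Longrightarrow> Y n i = 0"
      and Y: "\<And>n. p (\<lambda>i. unit k i + Y n i) < inverse (real (Suc n))"
      by metis
    \<comment> \<open>In differences of the \<open>Y n\<close> the summand \<open>unit k\<close>
      cancels and the rest lies in the span of the first \<open>k\<close> units, where the induction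
      hypothesis bounds coordinates by \<open>p\<close>.\<close>
    have "Cauchy (\<lambda>n. Y n i)" for i
    proof (rule metric_CauchyI)
      fix e :: real assume "0 < e"
      have "0 < e / (c + 1) / 2" using \<open>0 < e\<close> \<open>0 \<le> c\<close> by simp
      then obtain N where N: "inverse (real (Suc N)) < e / (c + 1) / 2"
        using reals_Archimedean by blast
      have "dist (Y n i) (Y n' i) < e" if "N \<le> n" "N \<le> n'" for n n'
      proof -
        have small: "p (\<lambda>i. unit k i + Y n i) < e / (c + 1) / 2" if "N \<le> n" for n
          using less_trans[OF less_le_trans[OF Y[of n]] N] that by (simp add: le_imp_inverse_le)
        have "\<bar>Y n i - Y n' i\<bar> \<le> c * p (\<lambda>i. Y n i - Y n' i)"
          by (rule c) (simp add: Y0)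
        also have "p (\<lambda>i. Y n i - Y n' i) \<le> p (\<lambda>i. unit k i + Y n i) + p (\<lambda>i. unit k i + Y n' i)"
          using triangle_diff[of "\<lambda>i. unit k i + Y n i" "\<lambda>i. unit k i + Y n' i"] by simp
        also have "\<dots> \<le> e / (c + 1)"
          using small[OF that(1)] small[OF that(2)] by linarith
        finally have "\<bar>Y n i - Y n' i\<bar> \<le> c * (e / (c + 1))"
          using \<open>0 \<le> c\<close> by (simp add: mult_left_mono)
        also have "\<dots> < e" using \<open>0 < e\<close> \<open>0 \<le> c\<close> by (simp add: field_simps)
        finally show ?thesis by (simp add: dist_real_def)
      qed
      then show "\<exists>N. \<forall>n\<ge>N. \<forall>n'\<ge>N. dist (Y n i) (Y n' i) < e" by blast
    qed
    then have lim: "(\<lambda>n. Y n i) \<longlonglongrightarrow> lim (\<lambda>n. Y n i)" for i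
      by (simp add: Cauchy_convergent_iff convergent_LIMSEQ_iff)
    define y where "y i = lim (\<lambda>n. Y n i)" for i
    have y: "(\<lambda>n. Y n i) \<longlonglongrightarrow> y i" for i
      using lim unfolding y_def .
    \<comment> \<open>\<open>le_coords\<close> turns coordinatewise convergence into an upper bound
      for \<open>p\<close> at the limit by a finite sum of null sequences.\<close>
    have "(\<lambda>n. inverse (real (Suc n)) + (\<Sum>j<m. \<bar>Y n j - y j\<bar> * p (unit j)))
        \<longlonglongrightarrow> 0 + (\<Sum>j<m. \<bar>y j - y j\<bar> * p (unit j))"
      by (intro tendsto_intros y LIMSEQ_inverse_real_of_nat)
    moreover have "p (\<lambda>i. unit k i + y i) \<le> inverse (real (Suc n)) + (\<Sum>j<m. \<bar>Y n j - y j\<bar> * p (unit j))" for n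
      using triangle_diff[of "\<lambda>i. unit k i + Y n i" "\<lambda>i. Y n i - y i"] Y[of n]
        le_coords[of "\<lambda>i. Y n i - y i"] by simp
    ultimately have "p (\<lambda>i. unit k i + y i) \<le> 0"
      by (intro LIMSEQ_le_const) auto
    then have "unit k k + y k = 0"
      using nonneg[of "\<lambda>i. unit k i + y i"] Suc.prems
      by (intro definite[of "\<lambda>i. unit k i + y i"]) auto
    moreover have "y k = 0"
      using y[of k] by (simp add: Y0 LIMSEQ_const_iff)
    ultimately show False by (simp add: unit_def)
  qed
  then obtain d where "0 < d"
    and d: "\<And>y. (\<And>i. k \<le> i \<Longrightarrow> y i = 0) \<Longrightarrow> d \<le> p (\<lambda>i. unit k i + y i)"
    by blast
  \<comment> \<open>The coordinate \<open>x k\<close> costs \<open>1 / d\<close>. The rest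
    \<open>x - x k * unit k\<close> costs \<open>c\<close> times its norm, which is at most
    \<open>p x * (1 + p (unit k) / d)\<close>.\<close>
  define C where "C = 1 / d + c * (1 + p (unit k) / d)"
  show ?case
  proof (intro exI[of _ C] conjI allI impI)
    show "0 \<le> C" using \<open>0 < d\<close> \<open>0 \<le> c\<close> nonneg[of "unit k"] by (simp add: C_def)
    fix x :: "nat \<Rightarrow> real" and i assume x: "\<forall>i. Suc k \<le> i \<longrightarrow> x i = 0"
    let ?y = "\<lambda>i. x i - x k * unit k i"
    have y0: "?y i = 0" if "k \<le> i" for i
      using x that by (cases "i = k") (auto simp: unit_def)
    have xk: "\<bar>x k\<bar> \<le> p x / d"
    proof (cases "x k = 0")
      case True
      then show ?thesis using nonneg[of x] \<open>0 < d\<close> by simp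
    next
      case False
      have "d \<le> p (\<lambda>i. unit k i + ?y i / x k)"
        by (rule d) (simp only: y0 div_0)
      also have "(\<lambda>i. unit k i + ?y i / x k) = (\<lambda>i. (1 / x k) * x i)"
        using False by (simp add: add_divide_distrib diff_divide_distrib)
      also have "p \<dots> = p x / \<bar>x k\<bar>"
        by (subst scale) simp
      finally show ?thesis using False \<open>0 < d\<close> by (simp add: field_simps)
    qed
    have "p ?y \<le> p x + \<bar>x k\<bar> * p (unit k)"
      using triangle_diff[of x "\<lambda>i. x k * unit k i"] by (simp add: scale)
    also have "\<dots> \<le> p x + p x / d * p (unit k)"
      by (intro add_left_mono mult_right_mono xk nonneg)
    finally have py: "c * p ?y \<le> c * (p x + p x / d * p (unit k))"
      by (rule mult_left_mono) fact
    have "\<bar>x i\<bar> \<le> p x / d + c * (p x + p x / d * p (unit k))"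
    proof (cases "i = k")
      case True
      then show ?thesis using xk \<open>0 \<le> c\<close> \<open>0 < d\<close> nonneg by (simp add: add_increasing2)
    next
      case False
      have "\<bar>?y i\<bar> \<le> c * p ?y"
        by (rule c) (simp only: y0)
      with False have "\<bar>x i\<bar> \<le> c * p ?y"
        by (simp add: unit_def)
      then show ?thesis using py nonneg[of x] \<open>0 < d\<close> by (simp add: add_increasing)
    qed
    then show "\<bar>x i\<bar> \<le> C * p x" by (simp add: C_def algebra_simps)
  qed
qed

text \<open>Cutting \<open>x\<close> off beyond \<open>m\<close> leaves \<open>p x\<close> unchanged
  by \<open>coord_cong\<close>, and the cut-off function lies in the span of the first
  \<open>m\<close> units.\<close>

lemma coords_le: "\<exists>c. \<forall>x. \<forall>i<m. \<bar>x i\<bar> \<le> c * p x"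
proof -
  obtain c where c: "\<And>x i. (\<And>i. m \<le> i \<Longrightarrow> x i = 0) \<Longrightarrow> \<bar>x i\<bar> \<le> c * p x"
    using coords_le_aux[OF order_refl] by blast
  have "\<bar>x i\<bar> \<le> c * p x" if "i < m" for x i
    using c[of "\<lambda>i. if i < m then x i else 0" i] that
      coord_cong[of "\<lambda>i. if i < m then x i else 0" x] by simp
  then show ?thesis by blast
qed

end

section \<open>Kronecker products acting on block vectors\<close>

lemma vsum_eq_vec:
  assumes "finite K" "\<And>k. k \<in> K \<Longrightarrow> f k \<in> carrier_vec m"
  shows "vsum m f K = vec m (\<lambda>i. \<Sum>k\<in>K. f k $ i)"
proof (rule eq_vecI)
  have "vsum m f K \<in> carrier_vec m"
    using assms by (intro finsum_vec_closed) auto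
  then show "dim_vec (vsum m f K) = dim_vec (vec m (\<lambda>i. \<Sum>k\<in>K. f k $ i))" by simp
  show "vsum m f K $ i = vec m (\<lambda>i. \<Sum>k\<in>K. f k $ i) $ i"
    if "i < dim_vec (vec m (\<lambda>i. \<Sum>k\<in>K. f k $ i))" for i
    using that assms by (simp add: index_finsum_vec Pi_def)
qed

lemma msum_eq_mat:
  assumes "finite K" "\<And>k. k \<in> K \<Longrightarrow> f k \<in> carrier_mat p q"
  shows "msum p q f K = mat p q (\<lambda>(i, j). \<Sum>k\<in>K. f k $$ (i, j))"
  using assms
proof (induction K)
  case empty
  interpret abelian_group "module_mat TYPE(real) p q" by (rule abelian_group_mat)
  show ?case by (auto simp: module_mat_simps)
next
  case (insert k K)
  interpret abelian_group "module_mat TYPE(real) p q" by (rule abelian_group_mat)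
  have "f k \<in> carrier_mat p q" using insert by simp
  have "msum p q f (insert k K) = f k + msum p q f K"
    using insert by (subst finsum_insert) (auto simp: module_mat_simps)
  also have "\<dots> = mat p q (\<lambda>(i, j). \<Sum>k\<in>insert k K. f k $$ (i, j))"
    using insert \<open>f k \<in> carrier_mat p q\<close> by (intro eq_matI) auto
  finally show ?case .
qed

lemma index_mult_mat_vec_sum:
  assumes "B \<in> carrier_mat a n" "x \<in> carrier_vec n" "i < a"
  shows "(B *\<^sub>v x) $ i = (\<Sum>j<n. B $$ (i, j) * x $ j)"
  using assms by (auto simp: scalar_prod_def atLeast0LessThan intro!: sum.cong)

lemma msum_mult_vec:
  assumes "finite K" "\<And>k. k \<in> K \<Longrightarrow> f k \<in> carrier_mat a n" "x \<in> carrier_vec n"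
  shows "msum a n f K *\<^sub>v x = vec a (\<lambda>i. \<Sum>k\<in>K. (f k *\<^sub>v x) $ i)"
proof (rule eq_vecI)
  fix i assume "i < dim_vec (vec a (\<lambda>i. \<Sum>k\<in>K. (f k *\<^sub>v x) $ i))"
  then have i: "i < a" by simp
  have M: "msum a n f K \<in> carrier_mat a n"
    using assms by (simp add: msum_eq_mat)
  have "(msum a n f K *\<^sub>v x) $ i = (\<Sum>j<n. (\<Sum>k\<in>K. f k $$ (i, j)) * x $ j)"
    unfolding index_mult_mat_vec_sum[OF M assms(3) i] using assms i by (simp add: msum_eq_mat)
  also have "\<dots> = (\<Sum>k\<in>K. (f k *\<^sub>v x) $ i)"
    by (simp add: index_mult_mat_vec_sum[OF assms(2) assms(3) i] sum_distrib_right sum.swap[of _ K]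
        del: index_mult_mat_vec)
  finally show "(msum a n f K *\<^sub>v x) $ i = vec a (\<lambda>i. \<Sum>k\<in>K. (f k *\<^sub>v x) $ i) $ i"
    using i by simp
qed (use assms in \<open>simp add: msum_eq_mat\<close>)

text \<open>The stacked vector of the stages, in the index order of \<open>kron\<close>: entry
  \<open>i * m + p\<close> belongs to stage \<open>i\<close> and component \<open>p\<close>. The
  bold matrices are studied through their action on such vectors, so their products never have to be
  computed entrywise.\<close>

definition block_vec :: "nat \<Rightarrow> nat \<Rightarrow> (nat \<Rightarrow> nat \<Rightarrow> real) \<Rightarrow> real vec" where
  "block_vec m s w = vec (s * m) (\<lambda>i. w (i div m) (i mod m))"

lemma block_vec_carrier [simp]: "block_vec m s w \<in> carrier_vec (s * m)"
  by (simp add: block_vec_def)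

lemma div_mod_less_mult:
  fixes i :: nat
  assumes "i < s * m"
  shows "i div m < s" "i mod m < m"
  using assms by (auto simp: less_mult_imp_div_less intro!: mod_less_divisor gr0I)

lemma block_index_less: "j < s \<Longrightarrow> q < m \<Longrightarrow> j * m + q < s * (m :: nat)"
  using mult_le_mono1[of "Suc j" s m] by simp

lemma block_vec_cong:
  "(\<And>i q. i < s \<Longrightarrow> q < m \<Longrightarrow> w i q = w' i q) \<Longrightarrow> block_vec m s w = block_vec m s w'"
  by (auto simp: block_vec_def div_mod_less_mult)

lemma block_vec_1: "block_vec m 1 (\<lambda>_. x) = vec m x"
  by (auto simp: block_vec_def)

lemma block_vec_add: "block_vec m s (\<lambda>i q. v i q + w i q) = block_vec m s v + block_vec m s w"
  by (auto simp: block_vec_def)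

lemma sum_blocks: "(\<Sum>i<s * m. f i) = (\<Sum>j<s. \<Sum>q<m. f (j * m + q))" for f :: "nat \<Rightarrow> real"
proof -
  have "(\<Sum>i = j * m..<j * m + m. f i) = (\<Sum>q<m. f (j * m + q))" for j
    using sum.shift_bounds_nat_ivl[of f 0 "j * m" m] by (simp add: atLeast0LessThan add.commute)
  then show ?thesis
    by (simp flip: sum.nat_group)
qed

lemma mult_block_vec:
  assumes "B \<in> carrier_mat a (s * m)"
  shows "B *\<^sub>v block_vec m s w = vec a (\<lambda>p. \<Sum>j<s. \<Sum>q<m. B $$ (p, j * m + q) * w j q)"
proof (rule eq_vecI)
  fix i assume "i < dim_vec (vec a (\<lambda>p. \<Sum>j<s. \<Sum>q<m. B $$ (p, j * m + q) * w j q))"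
  then have i: "i < a" by simp
  show "(B *\<^sub>v block_vec m s w) $ i = vec a (\<lambda>p. \<Sum>j<s. \<Sum>q<m. B $$ (p, j * m + q) * w j q) $ i"
    unfolding index_mult_mat_vec_sum[OF assms block_vec_carrier i] sum_blocks
    using i by (auto simp: block_vec_def block_index_less intro!: sum.cong)
qed (use assms in auto)

section \<open>Action of the Kronecker matrices of the method\<close>

lemma kron_carrier:
  "P \<in> carrier_mat a n \<Longrightarrow> Q \<in> carrier_mat c d \<Longrightarrow> kron P Q \<in> carrier_mat (a * c) (n * d)"
  by (auto simp: kron_def)

lemma kron_mult_block_vec:
  assumes "P \<in> carrier_mat a s" "Q \<in> carrier_mat m m"
  shows "kron P Q *\<^sub>v block_vec m s w =
    block_vec m a (\<lambda>i p. \<Sum>j<s. P $$ (i, j) * (\<Sum>q<m. Q $$ (p, q) * w j q))"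
  unfolding mult_block_vec[OF kron_carrier[OF assms]]
  using assms by (auto simp: block_vec_def kron_def block_index_less div_mod_less_mult
      sum_distrib_left mult.assoc intro!: sum.cong)

lemma kron_one_mult_block_vec:
  assumes "P \<in> carrier_mat a s"
  shows "kron P (1\<^sub>m m) *\<^sub>v block_vec m s w = block_vec m a (\<lambda>i p. \<Sum>j<s. P $$ (i, j) * w j p)"
  unfolding kron_mult_block_vec[OF assms one_carrier_mat]
  by (intro block_vec_cong sum.cong refl) (simp add: if_distrib[where f = "\<lambda>a. a * _"] cong: if_cong)

lemma bold_A_carrier: "A k \<in> carrier_mat s s \<Longrightarrow> bold_A m A k \<in> carrier_mat (s * m) (s * m)"
  unfolding bold_A_def by (intro kron_carrier) auto

lemma bold_bT_carrier: "b k \<in> carrier_vec s \<Longrightarrow> bold_bT m b k \<in> carrier_mat m (s * m)"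
  unfolding bold_bT_def using kron_carrier[of "mat_of_row (b k)" 1 s "1\<^sub>m m" m m] by auto

lemma bold_Z_carrier: "Z k \<in> carrier_mat m m \<Longrightarrow> bold_Z s Z k \<in> carrier_mat (s * m) (s * m)"
  unfolding bold_Z_def by (intro kron_carrier) auto

lemma bold_c_pow_carrier: "bold_c_pow m r s A j \<in> carrier_mat (s * m) m"
  unfolding bold_c_pow_def using kron_carrier[of "mat s 1 _" s 1 "1\<^sub>m m" m m] by auto

lemma bold_e_eq_bold_c_pow: "bold_e m s = bold_c_pow m r s A 0"
  by (auto simp: bold_e_def bold_c_pow_def intro!: arg_cong2[where f = kron])

lemma bold_A_mult_block_vec:
  "A k \<in> carrier_mat s s \<Longrightarrow>
    bold_A m A k *\<^sub>v block_vec m s w = block_vec m s (\<lambda>i p. \<Sum>j<s. A k $$ (i, j) * w j p)"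
  unfolding bold_A_def by (rule kron_one_mult_block_vec)

lemma bold_bT_mult_block_vec:
  assumes "b k \<in> carrier_vec s"
  shows "bold_bT m b k *\<^sub>v block_vec m s w = vec m (\<lambda>p. \<Sum>j<s. b k $ j * w j p)"
proof -
  have "bold_bT m b k *\<^sub>v block_vec m s w
      = block_vec m 1 (\<lambda>i p. \<Sum>j<s. mat_of_row (b k) $$ (i, j) * w j p)"
    unfolding bold_bT_def using assms by (intro kron_one_mult_block_vec) auto
  also have "\<dots> = block_vec m 1 (\<lambda>_ p. \<Sum>j<s. b k $ j * w j p)"
    using assms by (intro block_vec_cong) auto
  finally show ?thesis by (simp only: block_vec_1)
qed

lemma bold_Z_mult_block_vec:
  assumes "Z k \<in> carrier_mat m m"
  shows "bold_Z s Z k *\<^sub>v block_vec m s w = block_vec m s (\<lambda>j p. \<Sum>q<m. Z k $$ (p, q) * w j q)"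
  unfolding bold_Z_def kron_mult_block_vec[OF one_carrier_mat assms]
  by (intro block_vec_cong) (simp add: if_distrib[where f = "\<lambda>a. a * _"] cong: if_cong)

lemma bold_c_pow_mult_vec:
  "bold_c_pow m r s A j *\<^sub>v vec m x = block_vec m s (\<lambda>i p. (abscissae r s A $ i) ^ j * x p)"
  unfolding bold_c_pow_def block_vec_1[symmetric]
  by (subst kron_one_mult_block_vec[of _ s 1]) (auto intro!: block_vec_cong)

lemma bold_e_mult_vec: "bold_e m s *\<^sub>v vec m x = block_vec m s (\<lambda>_. x)"
  \<comment> \<open>A dummy tableau suffices: its abscissae are unspecified entries of an empty
    vector, but they are raised to the power 0, which gives 1.\<close>
  using bold_c_pow_mult_vec[of m 0 s "\<lambda>_. 0\<^sub>m 0 0" 0 x] bold_e_eq_bold_c_pow[of m s 0 "\<lambda>_. 0\<^sub>m 0 0"]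
  by simp

section \<open>The error recursion\<close>

lemma vec_index_eq: "v \<in> carrier_vec m \<Longrightarrow> vec m (($) v) = v"
  by (auto intro!: eq_vecI)

lemma coord_norm_of_vec_norm:
  assumes "is_vec_norm m nrm"
  shows "coord_norm m (\<lambda>x. nrm (vec m x))"
proof
  fix x y :: "nat \<Rightarrow> real" and a i
  show "nrm (vec m x) = nrm (vec m y)" if "\<And>i. i < m \<Longrightarrow> x i = y i"
    using that by (auto intro!: arg_cong[where f = nrm])
  have "vec m (\<lambda>i. x i + y i) = vec m x + vec m y" by auto
  then show "nrm (vec m (\<lambda>i. x i + y i)) \<le> nrm (vec m x) + nrm (vec m y)"
    using assms by (simp add: is_vec_norm_def)
  have "vec m (\<lambda>i. a * x i) = a \<cdot>\<^sub>v vec m x" by auto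
  then show "nrm (vec m (\<lambda>i. a * x i)) = \<bar>a\<bar> * nrm (vec m x)"
    using assms by (simp add: is_vec_norm_def)
  show "x i = 0" if "nrm (vec m x) = 0" "i < m"
  proof -
    have "vec m x = 0\<^sub>v m" using that assms by (simp add: is_vec_norm_def)
    then show ?thesis using that by (metis index_vec index_zero_vec(1))
  qed
qed

text \<open>\<open>Sup\<close> bounds its set only if the set is bounded above. On the unit sphere
  \<open>coords_le\<close> bounds the coordinates of \<open>y\<close>, hence those of
  \<open>B *\<^sub>v y\<close>, and \<open>le_coords\<close> returns to the norm. After that
  \<open>x\<close> is scaled to norm 1.\<close>

lemma norm_mult_mat_vec_le:
  assumes nrm: "is_vec_norm m nrm" and B: "B \<in> carrier_mat m m" and M: "induced_norm m nrm B \<le> M"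
    and x: "x \<in> carrier_vec m"
  shows "nrm (B *\<^sub>v x) \<le> M * nrm x"
proof (cases "x = 0\<^sub>v m")
  case True
  then have "B *\<^sub>v x = x" using B by auto
  moreover have "nrm x = 0" using True nrm x by (simp add: is_vec_norm_def)
  ultimately show ?thesis by simp
next
  case False
  interpret coord_norm m "\<lambda>x. nrm (vec m x)"
    using nrm by (rule coord_norm_of_vec_norm)
  obtain c where c: "\<And>y i. i < m \<Longrightarrow> \<bar>y i\<bar> \<le> c * nrm (vec m y)"
    using coords_le by blast
  have "bdd_above {nrm (B *\<^sub>v y) | y. y \<in> carrier_vec m \<and> nrm y = 1}"
  proof (rule bdd_aboveI)
    fix z assume "z \<in> {nrm (B *\<^sub>v y) | y. y \<in> carrier_vec m \<and> nrm y = 1}"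
    then obtain y where y: "y \<in> carrier_vec m" "nrm y = 1" and z: "z = nrm (B *\<^sub>v y)" by auto
    have "z = nrm (vec m (($) (B *\<^sub>v y)))"
      using B y by (simp add: z vec_index_eq)
    also have "\<dots> \<le> (\<Sum>i<m. \<bar>(B *\<^sub>v y) $ i\<bar> * nrm (vec m (unit i)))"
      by (rule le_coords)
    also have "\<dots> \<le> (\<Sum>i<m. (\<Sum>j<m. \<bar>B $$ (i, j)\<bar> * c) * nrm (vec m (unit i)))"
    proof (intro sum_mono mult_right_mono nonneg)
      fix i assume "i \<in> {..<m}"
      then have "\<bar>(B *\<^sub>v y) $ i\<bar> = \<bar>\<Sum>j<m. B $$ (i, j) * y $ j\<bar>"
        using index_mult_mat_vec_sum[OF B y(1)] by simp
      also have "\<dots> \<le> (\<Sum>j<m. \<bar>B $$ (i, j) * y $ j\<bar>)"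
        by (rule sum_abs)
      also have "\<dots> \<le> (\<Sum>j<m. \<bar>B $$ (i, j)\<bar> * c)"
        using c[of _ "($) y"] y by (auto simp: abs_mult vec_index_eq intro!: sum_mono mult_left_mono)
      finally show "\<bar>(B *\<^sub>v y) $ i\<bar> \<le> (\<Sum>j<m. \<bar>B $$ (i, j)\<bar> * c)" .
    qed
    finally show "z \<le> (\<Sum>i<m. (\<Sum>j<m. \<bar>B $$ (i, j)\<bar> * c) * nrm (vec m (unit i)))" .
  qed
  moreover have pos: "0 < nrm x"
    using False x nrm by (auto simp: is_vec_norm_def less_le)
  have "nrm ((1 / nrm x) \<cdot>\<^sub>v x) = \<bar>1 / nrm x\<bar> * nrm x"
    using nrm x unfolding is_vec_norm_def by blast
  then have "nrm ((1 / nrm x) \<cdot>\<^sub>v x) = 1"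
    using pos by simp
  ultimately have "nrm (B *\<^sub>v ((1 / nrm x) \<cdot>\<^sub>v x)) \<le> induced_norm m nrm B"
    unfolding induced_norm_def using x by (intro cSup_upper) auto
  also have "B *\<^sub>v ((1 / nrm x) \<cdot>\<^sub>v x) = (1 / nrm x) \<cdot>\<^sub>v (B *\<^sub>v x)"
    by (rule mult_mat_vec[OF B x])
  also have "nrm \<dots> = nrm (B *\<^sub>v x) / nrm x"
    using nrm x B pos mult_mat_vec_carrier[OF B x] by (simp add: is_vec_norm_def)
  finally have "nrm (B *\<^sub>v x) / nrm x \<le> M"
    using M by simp
  then show ?thesis
    using pos by (simp add: pos_divide_le_eq)
qed

section \<open>Stage matrix, its inverse and elimination of the stage errors\<close>

locale prk_matrices =
  fixes m r s :: nat and A :: "nat \<Rightarrow> real mat" and b :: "nat \<Rightarrow> real vec" and Z :: "nat \<Rightarrow> real mat"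
  assumes A [simp]: "k \<in> {1..r} \<Longrightarrow> A k \<in> carrier_mat s s"
    and b [simp]: "k \<in> {1..r} \<Longrightarrow> b k \<in> carrier_vec s"
    and Z [simp]: "k \<in> {1..r} \<Longrightarrow> Z k \<in> carrier_mat m m"
    and invertible: "invertible_mat (stage_matrix m r s A Z)"
begin

abbreviation "stage \<equiv> stage_matrix m r s A Z"
abbreviation "rt \<equiv> rT m r s A b Z"
abbreviation "c i \<equiv> abscissae r s A $ i"

lemma A_carrier: "k \<in> {1..r} \<Longrightarrow> bold_A m A k \<in> carrier_mat (s * m) (s * m)"
  by (rule bold_A_carrier) (rule A)

lemma b_carrier: "k \<in> {1..r} \<Longrightarrow> bold_bT m b k \<in> carrier_mat m (s * m)"
  by (rule bold_bT_carrier) (rule b)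

lemma Z_carrier: "k \<in> {1..r} \<Longrightarrow> bold_Z s Z k \<in> carrier_mat (s * m) (s * m)"
  by (rule bold_Z_carrier) (rule Z)

lemma AZ_carrier: "k \<in> {1..r} \<Longrightarrow> bold_A m A k * bold_Z s Z k \<in> carrier_mat (s * m) (s * m)"
  using A_carrier Z_carrier by (rule mult_carrier_mat)

lemma bZ_carrier: "k \<in> {1..r} \<Longrightarrow> bold_bT m b k * bold_Z s Z k \<in> carrier_mat m (s * m)"
  using b_carrier Z_carrier by (rule mult_carrier_mat)

lemma msum_AZ_carrier:
  "msum (s * m) (s * m) (\<lambda>k. bold_A m A k * bold_Z s Z k) {1..r} \<in> carrier_mat (s * m) (s * m)"
  by (subst msum_eq_mat) (auto intro: AZ_carrier)

lemma msum_bZ_carrier: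
  "msum m (s * m) (\<lambda>k. bold_bT m b k * bold_Z s Z k) {1..r} \<in> carrier_mat m (s * m)"
  by (subst msum_eq_mat) (auto intro: bZ_carrier)

lemma stage_carrier: "stage \<in> carrier_mat (s * m) (s * m)"
  unfolding stage_matrix_def by (rule minus_carrier_mat[OF msum_AZ_carrier])

lemma stage_mult:
  "stage *\<^sub>v block_vec m s w = block_vec m s (\<lambda>i p. w i p -
     (\<Sum>k=1..r. \<Sum>j<s. A k $$ (i, j) * (\<Sum>q<m. Z k $$ (p, q) * w j q)))"
proof -
  have AZ: "(bold_A m A k * bold_Z s Z k) *\<^sub>v block_vec m s w =
      block_vec m s (\<lambda>i p. \<Sum>j<s. A k $$ (i, j) * (\<Sum>q<m. Z k $$ (p, q) * w j q))"
    if k: "k \<in> {1..r}" for k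
    by (simp only: assoc_mult_mat_vec[OF A_carrier[OF k] Z_carrier[OF k]
          block_vec_carrier] bold_Z_mult_block_vec[where Z = Z, OF Z[OF k]] bold_A_mult_block_vec[where A = A, OF A[OF k]])
  have msum: "msum (s * m) (s * m) (\<lambda>k. bold_A m A k * bold_Z s Z k) {1..r} *\<^sub>v block_vec m s w =
      vec (s * m) (\<lambda>i. \<Sum>k=1..r. ((bold_A m A k * bold_Z s Z k) *\<^sub>v block_vec m s w) $ i)"
    by (rule msum_mult_vec[OF finite_atLeastAtMost AZ_carrier block_vec_carrier])
  have "stage *\<^sub>v block_vec m s w = block_vec m s w -
      vec (s * m) (\<lambda>i. \<Sum>k=1..r. ((bold_A m A k * bold_Z s Z k) *\<^sub>v block_vec m s w) $ i)"
    unfolding stage_matrix_def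
      minus_mult_distrib_mat_vec[OF one_carrier_mat msum_AZ_carrier block_vec_carrier]
      msum
      one_mult_mat_vec[OF block_vec_carrier] ..
  also have "\<dots> = block_vec m s w -
      vec (s * m) (\<lambda>i. \<Sum>k=1..r. block_vec m s (\<lambda>i p. \<Sum>j<s. A k $$ (i, j) *
        (\<Sum>q<m. Z k $$ (p, q) * w j q)) $ i)"
    by (simp only: AZ cong: sum.cong)
  also have "\<dots> = block_vec m s (\<lambda>i p. w i p -
     (\<Sum>k=1..r. \<Sum>j<s. A k $$ (i, j) * (\<Sum>q<m. Z k $$ (p, q) * w j q)))"
    by (rule eq_vecI) (auto simp: block_vec_def)
  finally show ?thesis .
qed

lemma update_mult:
  "msum m (s * m) (\<lambda>k. bold_bT m b k * bold_Z s Z k) {1..r} *\<^sub>v block_vec m s w =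
     vec m (\<lambda>p. \<Sum>k=1..r. \<Sum>j<s. b k $ j * (\<Sum>q<m. Z k $$ (p, q) * w j q))"
proof -
  have bZ: "(bold_bT m b k * bold_Z s Z k) *\<^sub>v block_vec m s w =
      vec m (\<lambda>p. \<Sum>j<s. b k $ j * (\<Sum>q<m. Z k $$ (p, q) * w j q))"
    if k: "k \<in> {1..r}" for k
    by (simp only: assoc_mult_mat_vec[OF b_carrier[OF k] Z_carrier[OF k]
          block_vec_carrier] bold_Z_mult_block_vec[where Z = Z, OF Z[OF k]] bold_bT_mult_block_vec[where b = b, OF b[OF k]])
  have "msum m (s * m) (\<lambda>k. bold_bT m b k * bold_Z s Z k) {1..r} *\<^sub>v block_vec m s w =
      vec m (\<lambda>p. \<Sum>k=1..r. ((bold_bT m b k * bold_Z s Z k) *\<^sub>v block_vec m s w) $ p)"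
    by (rule msum_mult_vec[OF finite_atLeastAtMost bZ_carrier block_vec_carrier])
  also have "\<dots> = vec m (\<lambda>p. \<Sum>k=1..r. \<Sum>j<s. b k $ j * (\<Sum>q<m. Z k $$ (p, q) * w j q))"
    by (rule eq_vecI) (simp_all only: bZ index_vec dim_vec cong: sum.cong)
  finally show ?thesis .
qed

lemma mat_inverse_stage:
  obtains B where "mat_inverse stage = Some B" "B * stage = 1\<^sub>m (s * m)" "B \<in> carrier_mat (s * m) (s * m)"
proof (cases "mat_inverse stage")
  case None
  \<comment> \<open>\<open>invertible_mat\<close> does not state the size of the inverse; it is read
    off from the dimensions of the two products. Then \<open>stage\<close> is a unit of the matrix
    ring, contradicting \<open>None\<close>. The \<open>undefined\<close> is merely the free
    parameter of \<open>ring_mat\<close>.\<close>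
  obtain B where B: "stage * B = 1\<^sub>m (s * m)" "B * stage = 1\<^sub>m (dim_row B)"
    using invertible stage_carrier by (auto simp: invertible_mat_def inverts_mat_def)
  have "dim_col (stage * B) = s * m" "dim_col (B * stage) = dim_row B"
    unfolding B by simp_all
  then have "B \<in> carrier_mat (s * m) (s * m)"
    using stage_carrier by auto
  then have "stage \<in> Units (ring_mat TYPE(real) (s * m) (undefined :: nat))"
    using B stage_carrier by (auto simp: Units_def ring_mat_def)
  then show ?thesis
    using mat_inverse(1)[OF stage_carrier None, of "undefined :: nat"] by blast
next
  case (Some B)
  then show ?thesis
    using mat_inverse(2)[OF stage_carrier Some] that by blast
qed

lemma rT_carrier: "rt \<in> carrier_mat m (s * m)"
proof (rule mat_inverse_stage)
  fix B assume "mat_inverse stage = Some B" "B \<in> carrier_mat (s * m) (s * m)"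
  then show ?thesis
    unfolding rT_def by (simp only: option.sel mult_carrier_mat[OF msum_bZ_carrier])
qed

text \<open>The left inverse cancels the stage matrix. Thus applying \<open>rt\<close> to the stage
  system yields the weighted sum over the stages without solving for the stages themselves.\<close>

lemma rT_mult_stage:
  assumes "x \<in> carrier_vec (s * m)"
  shows "rt *\<^sub>v (stage *\<^sub>v x) = msum m (s * m) (\<lambda>k. bold_bT m b k * bold_Z s Z k) {1..r} *\<^sub>v x"
proof (rule mat_inverse_stage)
  fix B assume B: "mat_inverse stage = Some B" "B * stage = 1\<^sub>m (s * m)" "B \<in> carrier_mat (s * m) (s * m)"
  have "B *\<^sub>v (stage *\<^sub>v x) = x"
    using assoc_mult_mat_vec[OF B(3) stage_carrier assms] B(2) assms by simp
  then show ?thesis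
    using assoc_mult_mat_vec[OF msum_bZ_carrier B(3) mult_mat_vec_carrier[OF stage_carrier assms]]
    by (simp add: rT_def B(1))
qed

lemma rT_mult_block_vec:
  "rt *\<^sub>v block_vec m s w = vec m (\<lambda>p. \<Sum>j<s. \<Sum>q<m. rt $$ (p, j * m + q) * w j q)"
  by (rule mult_block_vec[OF rT_carrier])

text \<open>The stage errors \<open>w\<close> solve a linear system with matrix \<^term>\<open>stage\<close>; eliminate them with \<^term>\<open>rt\<close>.\<close>

lemma error_recursion:
  assumes w: "\<And>i p. i < s \<Longrightarrow> p < m \<Longrightarrow> w i p = x p + P i p +
      (\<Sum>k=1..r. \<Sum>j<s. A k $$ (i, j) * (\<Sum>q<m. Z k $$ (p, q) * w j q))"
    and y: "\<And>p. p < m \<Longrightarrow> y p = x p + P0 p +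
      (\<Sum>k=1..r. \<Sum>j<s. b k $ j * (\<Sum>q<m. Z k $$ (p, q) * w j q))"
  shows "vec m y = R_mat m r s A b Z *\<^sub>v vec m x + (vec m P0 + rt *\<^sub>v block_vec m s P)"
proof -
  have e: "bold_e m s \<in> carrier_mat (s * m) m"
    using bold_c_pow_carrier by (metis bold_e_eq_bold_c_pow)
  have R: "R_mat m r s A b Z *\<^sub>v vec m x = vec m x + rt *\<^sub>v block_vec m s (\<lambda>_. x)"
    unfolding R_mat_def bold_e_mult_vec[symmetric]
    using rT_carrier e by (simp add: add_mult_distrib_mat_vec[of _ m m])
  \<comment> \<open>The hypothesis \<open>w\<close> in matrix form: the coupling terms move to the
    left, and the right-hand side splits into the initial error, repeated in every stage, and the
    stage defects. The first part yields \<open>R_mat\<close>, the second the local error.\<close>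
  have "stage *\<^sub>v block_vec m s w = block_vec m s (\<lambda>i p. x p + P i p)"
    unfolding stage_mult by (intro block_vec_cong) (use w in \<open>simp add: algebra_simps\<close>)
  also have "\<dots> = block_vec m s (\<lambda>_. x) + block_vec m s P"
    by (rule block_vec_add)
  finally have "rt *\<^sub>v (block_vec m s (\<lambda>_. x) + block_vec m s P) =
      vec m (\<lambda>p. \<Sum>k=1..r. \<Sum>j<s. b k $ j * (\<Sum>q<m. Z k $$ (p, q) * w j q))"
    using rT_mult_stage[OF block_vec_carrier, of w] update_mult[of w] by simp
  moreover have "rt *\<^sub>v (block_vec m s (\<lambda>_. x) + block_vec m s P) =
      rt *\<^sub>v block_vec m s (\<lambda>_. x) + rt *\<^sub>v block_vec m s P"
    by (rule mult_add_distrib_mat_vec[OF rT_carrier block_vec_carrier block_vec_carrier])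
  moreover have "vec m y = vec m x + vec m P0 +
      vec m (\<lambda>p. \<Sum>k=1..r. \<Sum>j<s. b k $ j * (\<Sum>q<m. Z k $$ (p, q) * w j q))"
    by (rule eq_vecI) (auto simp: y)
  ultimately have "vec m y = vec m x + vec m P0 +
      (rt *\<^sub>v block_vec m s (\<lambda>_. x) + rt *\<^sub>v block_vec m s P)"
    by simp
  then show ?thesis
    unfolding R using rT_carrier by (intro eq_vecI) auto
qed

text \<open>Both coefficients have the shape
  \<open>c0 ^ j - j * \<Sum>q. a q * c q ^ (j - 1)\<close>: with \<open>c0 = 1\<close> and the
  weights for the update, with \<open>c0 = c i\<close> and row \<open>i\<close> for the stages. This
  is the shape produced by \<open>taylor_defect_bound\<close>.\<close>

lemma d_coeff_mult_vec:
  assumes k: "k \<in> {1..r}"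
  shows "d_coeff m r s A b Z j k *\<^sub>v vec m x =
    vec m (\<lambda>p. (1 - real j * (\<Sum>q<s. b k $ q * c q ^ (j - 1))) * x p) +
    rt *\<^sub>v block_vec m s (\<lambda>i p. (c i ^ j - real j * (\<Sum>q<s. A k $$ (i, q) * c q ^ (j - 1))) * x p)"
proof -
  note C = bold_c_pow_carrier[of m r s A] and v = vec_carrier[of m x]
  have bc: "bold_bT m b k * bold_c_pow m r s A i \<in> carrier_mat m m"
    and Ac: "bold_A m A k * bold_c_pow m r s A i \<in> carrier_mat (s * m) m" for i
    by (rule mult_carrier_mat[OF b_carrier[OF k] C]
        mult_carrier_mat[OF A_carrier[OF k] C])+
  have sm: "(a \<cdot>\<^sub>m B) *\<^sub>v vec m x = a \<cdot>\<^sub>v (B *\<^sub>v vec m x)" if "B \<in> carrier_mat n m" for a :: real and B n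
    using that by (intro eq_vecI) (auto simp: scalar_prod_def sum_distrib_left mult.assoc)
  have "(1\<^sub>m m - real j \<cdot>\<^sub>m (bold_bT m b k * bold_c_pow m r s A (j - 1))) *\<^sub>v vec m x =
      vec m x - real j \<cdot>\<^sub>v vec m (\<lambda>p. \<Sum>q<s. b k $ q * (c q ^ (j - 1) * x p))"
    unfolding minus_mult_distrib_mat_vec[OF one_carrier_mat smult_carrier_mat[OF bc] v]
      sm[OF bc] one_mult_mat_vec[OF v] assoc_mult_mat_vec[OF b_carrier[OF k] C v]
      bold_c_pow_mult_vec bold_bT_mult_block_vec[where b = b, OF b[OF k]] ..
  also have "\<dots> = vec m (\<lambda>p. (1 - real j * (\<Sum>q<s. b k $ q * c q ^ (j - 1))) * x p)"
    by (rule eq_vecI) (auto simp: left_diff_distrib sum_distrib_left sum_distrib_right mult.assoc)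
  finally have 1: "(1\<^sub>m m - real j \<cdot>\<^sub>m (bold_bT m b k * bold_c_pow m r s A (j - 1))) *\<^sub>v vec m x = \<dots>" .
  have "(bold_c_pow m r s A j - real j \<cdot>\<^sub>m (bold_A m A k * bold_c_pow m r s A (j - 1))) *\<^sub>v vec m x =
      block_vec m s (\<lambda>i p. c i ^ j * x p) -
      real j \<cdot>\<^sub>v block_vec m s (\<lambda>i p. \<Sum>q<s. A k $$ (i, q) * (c q ^ (j - 1) * x p))"
    unfolding minus_mult_distrib_mat_vec[OF C smult_carrier_mat[OF Ac] v]
      sm[OF Ac] assoc_mult_mat_vec[OF A_carrier[OF k] C v]
      bold_c_pow_mult_vec bold_A_mult_block_vec[where A = A, OF A[OF k]] ..
  also have "\<dots> = block_vec m s
      (\<lambda>i p. (c i ^ j - real j * (\<Sum>q<s. A k $$ (i, q) * c q ^ (j - 1))) * x p)"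
    by (rule eq_vecI) (auto simp: block_vec_def left_diff_distrib sum_distrib_left sum_distrib_right mult.assoc)
  finally have 2: "(bold_c_pow m r s A j - real j \<cdot>\<^sub>m (bold_A m A k * bold_c_pow m r s A (j - 1))) *\<^sub>v vec m x
      = \<dots>" .
  have D: "bold_c_pow m r s A j - real j \<cdot>\<^sub>m (bold_A m A k * bold_c_pow m r s A (j - 1)) \<in> carrier_mat (s * m) m"
    by (rule minus_carrier_mat[OF smult_carrier_mat[OF Ac]])
  show ?thesis
    unfolding d_coeff_def
      add_mult_distrib_mat_vec[OF minus_carrier_mat[OF smult_carrier_mat[OF bc]]
        mult_carrier_mat[OF rT_carrier D] v]
      assoc_mult_mat_vec[OF rT_carrier D v] 1 2 ..
qed

text \<open>Read blockwise, \<open>rt\<close> is a row of \<open>s\<close> square matrices, each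
  acting on one stage, so the triangle inequality has \<open>s\<close> terms however large
  \<open>m\<close> is.\<close>

lemma norm_rT_mult_le:
  assumes nrm: "is_vec_norm m nrm" and M: "\<And>j. j < s \<Longrightarrow> induced_norm m nrm (r_block m r s A b Z j) \<le> M"
  shows "nrm (rt *\<^sub>v block_vec m s w) \<le> (\<Sum>j<s. M * nrm (vec m (w j)))"
proof -
  interpret coord_norm m "\<lambda>x. nrm (vec m x)"
    using nrm by (rule coord_norm_of_vec_norm)
  let ?B = "r_block m r s A b Z"
  have B: "?B j \<in> carrier_mat m m" for j
    by (simp add: r_block_def)
  have Bw: "vec m (($) (?B j *\<^sub>v vec m (w j))) = ?B j *\<^sub>v vec m (w j)" for j
    by (rule vec_index_eq[OF mult_mat_vec_carrier[OF B vec_carrier]])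
  have "(?B j *\<^sub>v vec m (w j)) $ p = (\<Sum>q<m. rt $$ (p, j * m + q) * w j q)" if "p < m" for j p
    unfolding index_mult_mat_vec_sum[OF B vec_carrier that] using that by (simp add: r_block_def)
  then have "rt *\<^sub>v block_vec m s w = vec m (\<lambda>p. \<Sum>j<s. (?B j *\<^sub>v vec m (w j)) $ p)"
    unfolding rT_mult_block_vec by (intro eq_vecI) (simp_all del: index_mult_mat_vec)
  then have "nrm (rt *\<^sub>v block_vec m s w) \<le> (\<Sum>j<s. nrm (vec m (($) (?B j *\<^sub>v vec m (w j)))))"
    using sum_le[of "\<lambda>j. ($) (?B j *\<^sub>v vec m (w j))" "{..<s}"] by simp
  also have "\<dots> \<le> (\<Sum>j<s. M * nrm (vec m (w j)))"
    unfolding Bw by (intro sum_mono norm_mult_mat_vec_le[OF nrm B M]) auto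
  finally show ?thesis .
qed

end

section \<open>Expansion and bound of the local error in one step\<close>

context prk_matrices
begin

text \<open>Pure linearity of \<open>rt\<close>: the polynomial parts taken out of the update and
  stage defects recombine into \<open>d_coeff\<close>. The power \<open>1 ^ j\<close> is left
  unevaluated so that the update remainder has literally the form of a stage remainder with
  \<open>c0 = 1\<close>.\<close>

lemma local_error_expansion:
  fixes X :: "nat \<Rightarrow> nat \<Rightarrow> real vec" and a :: "nat \<Rightarrow> real"
  assumes X: "\<And>k j. k \<in> {1..r} \<Longrightarrow> j < l \<Longrightarrow> X k j \<in> carrier_vec m"
  shows "vec m P0 + rt *\<^sub>v block_vec m s P =
    vsum m (\<lambda>j. a j \<cdot>\<^sub>v vsum m (\<lambda>k. d_coeff m r s A b Z j k *\<^sub>v X k (j - 1)) {1..r}) {1..l} +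
    (vec m (\<lambda>p. P0 p - (\<Sum>j=1..l. a j *
        (\<Sum>k=1..r. (1 ^ j - real j * (\<Sum>q<s. b k $ q * c q ^ (j - 1))) * X k (j - 1) $ p))) +
     rt *\<^sub>v block_vec m s (\<lambda>i p. P i p - (\<Sum>j=1..l. a j *
        (\<Sum>k=1..r. (c i ^ j - real j * (\<Sum>q<s. A k $$ (i, q) * c q ^ (j - 1))) * X k (j - 1) $ p))))"
proof -
  define \<beta> where "\<beta> j k = 1 - real j * (\<Sum>q<s. b k $ q * c q ^ (j - 1))" for j k
  define \<gamma> where "\<gamma> j k i = c i ^ j - real j * (\<Sum>q<s. A k $$ (i, q) * c q ^ (j - 1))" for j k i
  define \<Lambda> where "\<Lambda> w p = (\<Sum>i<s. \<Sum>q<m. rt $$ (p, i * m + q) * w i q)" for w p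
  have \<Lambda>_diff: "\<Lambda> (\<lambda>i q. v i q - w i q) p = \<Lambda> v p - \<Lambda> w p" for v w p
    by (simp add: \<Lambda>_def right_diff_distrib sum_subtractf)
  have \<Lambda>_mult: "\<Lambda> (\<lambda>i q. y * w i q) p = y * \<Lambda> w p" for y w p
    by (simp add: \<Lambda>_def sum_distrib_left mult_ac)
  have \<Lambda>_sum: "\<Lambda> (\<lambda>i q. \<Sum>k\<in>K. w k i q) p = (\<Sum>k\<in>K. \<Lambda> (w k) p)" for K :: "nat set" and w p
    by (simp add: \<Lambda>_def sum_distrib_left sum.swap[of _ K])
  have rt: "rt *\<^sub>v block_vec m s w = vec m (\<Lambda> w)" for w
    by (auto simp: rT_mult_block_vec \<Lambda>_def)
  have d: "d_coeff m r s A b Z j k *\<^sub>v X k (j - 1) =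
      vec m (\<lambda>p. \<beta> j k * X k (j - 1) $ p + \<Lambda> (\<lambda>i q. \<gamma> j k i * X k (j - 1) $ q) p)"
    if "j \<in> {1..l}" "k \<in> {1..r}" for j k
    using d_coeff_mult_vec[OF that(2), of j "($) (X k (j - 1))"] X[OF that(2), of "j - 1"] that
    by (auto simp: vec_index_eq rt \<beta>_def \<gamma>_def)
  have vsum_r: "vsum m (\<lambda>k. d_coeff m r s A b Z j k *\<^sub>v X k (j - 1)) {1..r} =
      vec m (\<lambda>p. \<Sum>k=1..r. \<beta> j k * X k (j - 1) $ p + \<Lambda> (\<lambda>i q. \<gamma> j k i * X k (j - 1) $ q) p)"
    if "j \<in> {1..l}" for j
    by (subst vsum_eq_vec) (simp_all only: d[OF that] finite_atLeastAtMost vec_carrier,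
        auto simp: d[OF that, simplified])
  have vsum_l: "vsum m (\<lambda>j. a j \<cdot>\<^sub>v vsum m (\<lambda>k. d_coeff m r s A b Z j k *\<^sub>v X k (j - 1)) {1..r}) {1..l} =
      vec m (\<lambda>p. \<Sum>j=1..l. a j *
        (\<Sum>k=1..r. \<beta> j k * X k (j - 1) $ p + \<Lambda> (\<lambda>i q. \<gamma> j k i * X k (j - 1) $ q) p))"
    by (subst vsum_eq_vec) (simp_all only: vsum_r finite_atLeastAtMost smult_carrier_vec vec_carrier,
        auto simp: vsum_r[simplified])
  show ?thesis
    unfolding vsum_l rt power_one \<beta>_def[symmetric] \<gamma>_def[symmetric] \<Lambda>_diff \<Lambda>_sum \<Lambda>_mult
    by (rule eq_vecI) (simp_all add: sum.distrib distrib_left \<Lambda>_diff \<Lambda>_sum \<Lambda>_mult)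
qed

end

text \<open>The factor of \<open>h ^ (l + 1)\<close> in \<open>taylor_defect_bound\<close> for
  \<open>K = {1..r}\<close>: the first term is the remainder of \<open>u\<close>, the double sum
  collects those of the \<open>\<phi>\<close>.\<close>

definition defect_const :: "nat \<Rightarrow> nat \<Rightarrow> nat \<Rightarrow> (nat \<Rightarrow> real) \<Rightarrow> (nat \<Rightarrow> nat \<Rightarrow> real) \<Rightarrow> real \<Rightarrow> real" where
  "defect_const r s l c a c0 =
     real r * \<bar>c0\<bar> ^ (l + 1) / fact (l + 1) + (\<Sum>k=1..r. \<Sum>q<s. \<bar>a k q\<bar> * \<bar>c q\<bar> ^ l / fact l)"

text \<open>The step starts from an arbitrary \<open>x\<close>, so it can be used for every
  \<open>n\<close> independently. The analysis takes place on the hull \<open>J\<close> of the step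
  times, which is compact and is the interval over which the supremum in the claim runs.\<close>

lemma prk_local_error:
  fixes r s :: nat and A :: "nat \<Rightarrow> real mat"
  defines "c \<equiv> \<lambda>i. abscissae r s A $ i"
  assumes nrm: "is_vec_norm m nrm" and h: "0 < h" and "0 < M"
    and coeffs: "\<forall>k\<in>{1..r}. A k \<in> carrier_mat s s \<and> b k \<in> carrier_vec s"
    and L: "\<forall>k\<in>{1..r}. L k \<in> carrier_mat m m"
    and Zh: "\<forall>k\<in>{1..r}. Z k = h \<cdot>\<^sub>m L k"
    and T: "\<forall>x\<in>T. \<forall>y\<in>T. {x..y} \<subseteq> T" "step_times r s A h n \<subseteq> T"
    and g: "\<forall>k\<in>{1..r}. \<forall>t\<in>T. g k t \<in> carrier_vec m"
    and u: "\<forall>t\<in>T. u t \<in> carrier_vec m"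
    and u': "\<forall>t\<in>T. has_vec_deriv m u
         (msum m m L {1..r} *\<^sub>v u t + vsum m (\<lambda>k. g k t) {1..r}) (at t within T)"
    and \<phi>: "\<forall>k\<in>{1..r}. C_with_derivs m l T (\<lambda>t. split_rhs L g k t (u t)) (\<phi> k)"
    and inv: "invertible_mat (stage_matrix m r s A Z)"
    and M: "\<forall>j<s. induced_norm m nrm (r_block m r s A b Z j) \<le> M"
    and step: "prk_step m r s A b (split_rhs L g) h (real n * h) x V y"
  shows "\<exists>\<delta> \<rho>. \<delta> \<in> carrier_vec m \<and> \<rho> \<in> carrier_vec m \<and>
     u (real (Suc n) * h) - y = R_mat m r s A b Z *\<^sub>v (u (real n * h) - x) + \<delta> \<and>
     \<delta> = vsum m (\<lambda>j. (h ^ j / fact j) \<cdot>\<^sub>v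
           vsum m (\<lambda>k. d_coeff m r s A b Z j k *\<^sub>v \<phi> k (j - 1) (real n * h)) {1..r}) {1..l} + \<rho> \<and>
     nrm \<rho> \<le> (defect_const r s l c (\<lambda>k q. b k $ q) 1 +
           M * (\<Sum>i<s. defect_const r s l c (\<lambda>k q. A k $$ (i, q)) (c i))) * h ^ (l + 1) *
       Sup {nrm (\<phi> k l t) | k t. k \<in> {1..r} \<and> t \<in> step_interval r s A h n}"
proof -
  interpret coord_norm m "\<lambda>x. nrm (vec m x)"
    using nrm by (rule coord_norm_of_vec_norm)
  interpret prk_matrices m r s A b Z
    using coeffs L Zh inv by unfold_locales auto
  define t where "t = real n * h"
  define J where "J = step_interval r s A h n"
  define S where "S = Sup {nrm (\<phi> k l t) | k t. k \<in> {1..r} \<and> t \<in> J}"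
  have t': "real (Suc n) * h = t + 1 * h" by (simp add: t_def algebra_simps)
  obtain \<alpha> \<beta> where J_eq: "J = {\<alpha>..\<beta>}" and \<alpha>\<beta>: "\<alpha> \<in> step_times r s A h n" "\<beta> \<in> step_times r s A h n"
    and times: "step_times r s A h n \<subseteq> J"
  proof
    have fin: "finite (step_times r s A h n)" "step_times r s A h n \<noteq> {}"
      by (auto simp: step_times_def)
    show "J = {Min (step_times r s A h n)..Max (step_times r s A h n)}"
      by (simp add: J_def step_interval_def)
    show "Min (step_times r s A h n) \<in> step_times r s A h n" "Max (step_times r s A h n) \<in> step_times r s A h n"
      using fin by auto
    show "step_times r s A h n \<subseteq> J"
      using fin by (auto simp: J_def step_interval_def)
  qed
  have J: "t \<in> J" "t + 1 * h \<in> J" "\<And>i. i < s \<Longrightarrow> t + c i * h \<in> J"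
    using times by (auto simp: step_times_def c_def t_def algebra_simps)
  \<comment> \<open>The end points of \<open>J\<close> are step times, hence in \<open>T\<close>,
    and \<open>T\<close> contains everything between two of its points.\<close>
  have JT: "J \<subseteq> T"
    using T \<alpha>\<beta> by (auto simp: J_eq subset_iff)
  note JT' = subsetD[OF JT]
  have \<phi>_carrier: "\<phi> k j \<tau> \<in> carrier_vec m" if "k \<in> {1..r}" "j \<le> l" "\<tau> \<in> J" for k j \<tau>
    using \<phi> that JT by (auto simp: C_with_derivs_def)
  have \<phi>_0: "\<phi> k 0 \<tau> = L k *\<^sub>v u \<tau> + g k \<tau>" if "k \<in> {1..r}" "\<tau> \<in> J" for k \<tau>
    using \<phi> that JT by (auto simp: C_with_derivs_def split_rhs_def)
  have \<phi>_deriv: "((\<lambda>\<tau>. \<phi> k j \<tau> $ i) has_field_derivative \<phi> k (Suc j) \<tau> $ i) (at \<tau> within J)"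
    if "k \<in> {1..r}" "j < l" "i < m" "\<tau> \<in> J" for k j i \<tau>
    using \<phi> that JT by (auto simp: C_with_derivs_def has_vec_deriv_def intro!: DERIV_subset[OF _ JT])
  have u_deriv: "((\<lambda>\<tau>. u \<tau> $ i) has_field_derivative (\<Sum>k=1..r. \<phi> k 0 \<tau> $ i)) (at \<tau> within J)"
    if "i < m" "\<tau> \<in> J" for i \<tau>
  proof -
    have "msum m m L {1..r} *\<^sub>v u \<tau> = vec m (\<lambda>i. \<Sum>k=1..r. (L k *\<^sub>v u \<tau>) $ i)"
      using L u JT' that by (intro msum_mult_vec) auto
    moreover have "vsum m (\<lambda>k. g k \<tau>) {1..r} = vec m (\<lambda>i. \<Sum>k=1..r. g k \<tau> $ i)"
      using g JT' that by (intro vsum_eq_vec) auto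
    moreover have "\<phi> k 0 \<tau> $ i = (L k *\<^sub>v u \<tau>) $ i + g k \<tau> $ i" if "k \<in> {1..r}" for k
    proof -
      have "g k \<tau> \<in> carrier_vec m" using g that JT'[OF \<open>\<tau> \<in> J\<close>] by blast
      then show ?thesis
        unfolding \<phi>_0[OF that \<open>\<tau> \<in> J\<close>] using \<open>i < m\<close> by (intro index_add_vec) auto
    qed
    ultimately have "(msum m m L {1..r} *\<^sub>v u \<tau> + vsum m (\<lambda>k. g k \<tau>) {1..r}) $ i = (\<Sum>k=1..r. \<phi> k 0 \<tau> $ i)"
      using \<open>i < m\<close> by (simp add: sum.distrib)
    moreover have "((\<lambda>\<tau>. u \<tau> $ i) has_field_derivative
        (msum m m L {1..r} *\<^sub>v u \<tau> + vsum m (\<lambda>k. g k \<tau>) {1..r}) $ i) (at \<tau> within J)"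
      using u' that JT' JT by (auto simp: has_vec_deriv_def intro!: DERIV_subset[OF _ JT])
    ultimately show ?thesis by simp
  qed
  have S: "nrm (vec m (\<lambda>i. \<phi> k l \<tau> $ i)) \<le> S" if "k \<in> {1..r}" "\<tau> \<in> J" for k \<tau>
  proof -
    have "bdd_above ((\<lambda>\<tau>. nrm (\<phi> k l \<tau>)) ` J)" if k: "k \<in> {1..r}" for k
    proof -
      have "continuous_on J (\<lambda>\<tau>. \<phi> k l \<tau> $ i)" if "i < m" for i
        using \<phi> k that JT by (auto simp: C_with_derivs_def intro!: continuous_on_subset[OF _ JT])
      \<comment> \<open>For \<open>Sup\<close> to be an upper bound, its set must be bounded. The
        norm is dominated by a continuous function of the coordinates, which attains its maximum on
        the compact \<open>J\<close>.\<close>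
      then have "continuous_on J (\<lambda>\<tau>. \<Sum>i<m. \<bar>\<phi> k l \<tau> $ i\<bar> * nrm (vec m (unit i)))"
        by (auto intro!: continuous_intros)
      moreover have "compact J" "J \<noteq> {}" using J by (auto simp: J_eq)
      ultimately obtain \<tau>0 where \<tau>0: "\<And>\<tau>. \<tau> \<in> J \<Longrightarrow> (\<Sum>i<m. \<bar>\<phi> k l \<tau> $ i\<bar> * nrm (vec m (unit i)))
          \<le> (\<Sum>i<m. \<bar>\<phi> k l \<tau>0 $ i\<bar> * nrm (vec m (unit i)))"
        using continuous_attains_sup[of J] by blast
      show ?thesis
      proof (rule bdd_aboveI2)
        fix \<tau> assume "\<tau> \<in> J"
        then have "vec m (($) (\<phi> k l \<tau>)) = \<phi> k l \<tau>"
          using \<phi>_carrier[OF k] by (simp add: vec_index_eq)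
        then show "nrm (\<phi> k l \<tau>) \<le> (\<Sum>i<m. \<bar>\<phi> k l \<tau>0 $ i\<bar> * nrm (vec m (unit i)))"
          using order_trans[OF le_coords \<tau>0[OF \<open>\<tau> \<in> J\<close>]] by simp
      qed
    qed
    then have "bdd_above (\<Union>k\<in>{1..r}. (\<lambda>\<tau>. nrm (\<phi> k l \<tau>)) ` J)"
      by simp
    also have "(\<Union>k\<in>{1..r}. (\<lambda>\<tau>. nrm (\<phi> k l \<tau>)) ` J) = {nrm (\<phi> k l t) | k t. k \<in> {1..r} \<and> t \<in> J}"
      by blast
    finally have "nrm (\<phi> k l \<tau>) \<le> S"
      unfolding S_def using that by (intro cSup_upper) blast+
    then show ?thesis
      using \<phi>_carrier[OF that(1) order_refl that(2)] by (simp add: vec_index_eq)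
  qed
  \<comment> \<open>\<open>P a c0\<close> is the defect of the exact solution and
    \<open>W a c0\<close> what remains after removing the terms up to order \<open>l\<close>; row
    and abscissa are parameters so that stages and update share all estimates.\<close>
  define P where "P a c0 p = u (t + c0 * h) $ p - u t $ p -
      h * (\<Sum>k=1..r. \<Sum>q<s. a k q * \<phi> k 0 (t + c q * h) $ p)" for a c0 p
  define W where "W a c0 p = P a c0 p - (\<Sum>j=1..l. h ^ j / fact j *
      (\<Sum>k=1..r. (c0 ^ j - real j * (\<Sum>q<s. a k q * c q ^ (j - 1))) * \<phi> k (j - 1) t $ p))" for a c0 p
  have W: "nrm (vec m (W a c0)) \<le> defect_const r s l c a c0 * h ^ (l + 1) * S"
    if "t + c0 * h \<in> J" for a c0
    using taylor_defect_bound[of "{1..r}" h t \<alpha> \<beta> c0 s c "\<lambda>\<tau> i. u \<tau> $ i" "\<lambda>k j \<tau> i. \<phi> k j \<tau> $ i" l S a]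
      h J that u_deriv \<phi>_deriv S
    unfolding J_eq W_def[abs_def] P_def defect_const_def by simp
  let ?PA = "\<lambda>i. P (\<lambda>k q. A k $$ (i, q)) (c i)" and ?Pb = "P (\<lambda>k q. b k $ q) 1"
  let ?WA = "\<lambda>i. W (\<lambda>k q. A k $$ (i, q)) (c i)" and ?Wb = "W (\<lambda>k q. b k $ q) 1"
  define w where "w i p = u (t + c i * h) $ p - V i $ p" for i p
  have xy: "x \<in> carrier_vec m" "y \<in> carrier_vec m" and V: "\<And>i. i < s \<Longrightarrow> V i \<in> carrier_vec m"
    using step by (auto simp: prk_step_def)
  have F: "split_rhs L g k (t + c j * h) (V j) \<in> carrier_vec m" if "k \<in> {1..r}" "j < s" for k j
    unfolding split_rhs_def
    using L g that JT'[OF J(3)[OF that(2)]] V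
    by (intro add_carrier_vec mult_mat_vec_carrier[where n = m]) blast+
  have ut: "u t \<in> carrier_vec m" "u (t + 1 * h) \<in> carrier_vec m"
    using u JT' J by auto
  \<comment> \<open>The right-hand side is affine, so \<open>g k\<close> cancels between exact and
    numerical stage, and \<open>h\<close> times \<open>L k\<close> is \<open>Z k\<close>.\<close>
  have Zw: "h * \<phi> k 0 (t + c j * h) $ p - h * split_rhs L g k (t + c j * h) (V j) $ p =
      (\<Sum>q<m. Z k $$ (p, q) * w j q)" if k: "k \<in> {1..r}" and j: "j < s" and p: "p < m" for k j p
  proof -
    have Lk: "L k \<in> carrier_mat m m" and Zk: "Z k = h \<cdot>\<^sub>m L k" using L Zh k by blast+
    have uj: "u (t + c j * h) \<in> carrier_vec m" and gj: "g k (t + c j * h) \<in> carrier_vec m"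
      using u g k JT'[OF J(3)[OF j]] by blast+
    have "h * \<phi> k 0 (t + c j * h) $ p - h * split_rhs L g k (t + c j * h) (V j) $ p =
        h * ((L k *\<^sub>v u (t + c j * h)) $ p - (L k *\<^sub>v V j) $ p)"
      using Lk gj p unfolding \<phi>_0[OF k J(3)[OF j]] split_rhs_def
      by (simp add: algebra_simps del: index_mult_mat_vec)
    also have "\<dots> = (\<Sum>q<m. Z k $$ (p, q) * w j q)"
      unfolding index_mult_mat_vec_sum[OF Lk uj p] index_mult_mat_vec_sum[OF Lk V[OF j] p] Zk w_def
      using Lk p by (simp add: algebra_simps sum_subtractf sum_distrib_left)
    finally show ?thesis .
  qed
  have inc: "vsum m (\<lambda>k. vsum m (\<lambda>j. a k j \<cdot>\<^sub>v split_rhs L g k (t + c j * h) (V j)) {..<s}) {1..r} =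
      vec m (\<lambda>p. \<Sum>k=1..r. \<Sum>j<s. a k j * split_rhs L g k (t + c j * h) (V j) $ p)" for a
  proof -
    have 1: "vsum m (\<lambda>j. a k j \<cdot>\<^sub>v split_rhs L g k (t + c j * h) (V j)) {..<s} =
        vec m (\<lambda>p. \<Sum>j<s. a k j * split_rhs L g k (t + c j * h) (V j) $ p)" if "k \<in> {1..r}" for k
    proof -
      have "vsum m (\<lambda>j. a k j \<cdot>\<^sub>v split_rhs L g k (t + c j * h) (V j)) {..<s} =
          vec m (\<lambda>p. \<Sum>j<s. (a k j \<cdot>\<^sub>v split_rhs L g k (t + c j * h) (V j)) $ p)"
        using F[OF that] by (intro vsum_eq_vec) auto
      also have "\<dots> = vec m (\<lambda>p. \<Sum>j<s. a k j * split_rhs L g k (t + c j * h) (V j) $ p)"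
        using carrier_vecD[OF F[OF that]] by (intro eq_vecI) auto
      finally show ?thesis .
    qed
    have "vsum m (\<lambda>k. vsum m (\<lambda>j. a k j \<cdot>\<^sub>v split_rhs L g k (t + c j * h) (V j)) {..<s}) {1..r} =
      vec m (\<lambda>p. \<Sum>k=1..r. vsum m (\<lambda>j. a k j \<cdot>\<^sub>v split_rhs L g k (t + c j * h) (V j)) {..<s} $ p)"
      using 1 by (intro vsum_eq_vec) auto
    also have "\<dots> = vec m (\<lambda>p. \<Sum>k=1..r. \<Sum>j<s. a k j * split_rhs L g k (t + c j * h) (V j) $ p)"
      by (rule eq_vecI) (simp_all only: 1 index_vec dim_vec cong: sum.cong)
    finally show ?thesis .
  qed
  \<comment> \<open>One identity yields both hypotheses of \<open>error_recursion\<close>: with row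
    \<open>i\<close> and \<open>c i\<close> for the stages, with the weights and 1 for the
    update.\<close>
  have eq: "u (t + c0 * h) $ p - z $ p = (u t $ p - x $ p) + P a c0 p +
      (\<Sum>k=1..r. \<Sum>j<s. a k j * (\<Sum>q<m. Z k $$ (p, q) * w j q))"
    if z: "z = x + h \<cdot>\<^sub>v vsum m (\<lambda>k. vsum m (\<lambda>j. a k j \<cdot>\<^sub>v split_rhs L g k (t + c j * h) (V j)) {..<s}) {1..r}"
      and p: "p < m" for z a c0 p
  proof -
    have "z $ p = x $ p + h * (\<Sum>k=1..r. \<Sum>j<s. a k j * split_rhs L g k (t + c j * h) (V j) $ p)"
      unfolding z inc using p by simp
    moreover have "(\<Sum>k=1..r. \<Sum>j<s. a k j * (\<Sum>q<m. Z k $$ (p, q) * w j q)) =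
        (\<Sum>k=1..r. \<Sum>j<s. a k j * (h * \<phi> k 0 (t + c j * h) $ p -
          h * split_rhs L g k (t + c j * h) (V j) $ p))"
      using p by (simp add: Zw)
    then have "(\<Sum>k=1..r. \<Sum>j<s. a k j * (\<Sum>q<m. Z k $$ (p, q) * w j q)) =
        h * (\<Sum>k=1..r. \<Sum>j<s. a k j * \<phi> k 0 (t + c j * h) $ p) -
        h * (\<Sum>k=1..r. \<Sum>j<s. a k j * split_rhs L g k (t + c j * h) (V j) $ p)"
      by (simp add: right_diff_distrib sum_subtractf sum_distrib_left mult_ac)
    ultimately show ?thesis
      by (simp add: P_def)
  qed
  have stages: "V i = x + h \<cdot>\<^sub>v vsum m (\<lambda>k. vsum m (\<lambda>j. A k $$ (i, j) \<cdot>\<^sub>v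
      split_rhs L g k (t + c j * h) (V j)) {..<s}) {1..r}" if "i < s" for i
    using step that unfolding prk_step_def t_def c_def by blast
  have update: "y = x + h \<cdot>\<^sub>v vsum m (\<lambda>k. vsum m (\<lambda>j. b k $ j \<cdot>\<^sub>v
      split_rhs L g k (t + c j * h) (V j)) {..<s}) {1..r}"
    using step unfolding prk_step_def t_def c_def by blast
  define \<delta> where "\<delta> = vec m ?Pb + rt *\<^sub>v block_vec m s ?PA"
  define \<rho> where "\<rho> = vec m ?Wb + rt *\<^sub>v block_vec m s ?WA"
  have rt_carrier: "rt *\<^sub>v block_vec m s v \<in> carrier_vec m" for v
    by (rule mult_mat_vec_carrier[OF rT_carrier block_vec_carrier])
  have "vec m (\<lambda>p. u (t + 1 * h) $ p - y $ p) = R_mat m r s A b Z *\<^sub>v vec m (\<lambda>p. u t $ p - x $ p) + \<delta>"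
    unfolding \<delta>_def
    by (rule error_recursion[where w = w]) (simp_all only: w_def eq[OF stages] eq[OF update])
  moreover have "vec m (\<lambda>p. u (t + 1 * h) $ p - y $ p) = u (t + 1 * h) - y"
    "vec m (\<lambda>p. u t $ p - x $ p) = u t - x"
    using xy ut by (auto intro!: eq_vecI)
  ultimately have "u (t + 1 * h) - y = R_mat m r s A b Z *\<^sub>v (u t - x) + \<delta>"
    by (simp only:)
  moreover have "\<delta> = vsum m (\<lambda>j. (h ^ j / fact j) \<cdot>\<^sub>v
           vsum m (\<lambda>k. d_coeff m r s A b Z j k *\<^sub>v \<phi> k (j - 1) t) {1..r}) {1..l} + \<rho>"
    unfolding \<delta>_def \<rho>_def W_def c_def
    by (rule local_error_expansion[where X = "\<lambda>k j. \<phi> k j t"]) (use \<phi>_carrier J in simp)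
  moreover have "nrm \<rho> \<le> (defect_const r s l c (\<lambda>k q. b k $ q) 1 +
      M * (\<Sum>i<s. defect_const r s l c (\<lambda>k q. A k $$ (i, q)) (c i))) * h ^ (l + 1) * S"
  proof -
    have "nrm \<rho> \<le> nrm (vec m ?Wb) + nrm (rt *\<^sub>v block_vec m s ?WA)"
      using nrm rt_carrier unfolding \<rho>_def is_vec_norm_def by auto
    also have "\<dots> \<le> nrm (vec m ?Wb) + (\<Sum>i<s. M * nrm (vec m (?WA i)))"
      by (intro add_left_mono norm_rT_mult_le[OF nrm]) (use M in simp)
    also have "\<dots> \<le> defect_const r s l c (\<lambda>k q. b k $ q) 1 * h ^ (l + 1) * S +
        (\<Sum>i<s. M * (defect_const r s l c (\<lambda>k q. A k $$ (i, q)) (c i) * h ^ (l + 1) * S))"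
      using \<open>0 < M\<close> by (intro add_mono sum_mono mult_left_mono W J) auto
    also have "\<dots> = (defect_const r s l c (\<lambda>k q. b k $ q) 1 +
      M * (\<Sum>i<s. defect_const r s l c (\<lambda>k q. A k $$ (i, q)) (c i))) * h ^ (l + 1) * S"
      by (simp add: algebra_simps sum_distrib_left sum_distrib_right)
    finally show ?thesis .
  qed
  moreover have "\<delta> \<in> carrier_vec m" "\<rho> \<in> carrier_vec m"
    unfolding \<delta>_def \<rho>_def using rt_carrier by auto
  ultimately show ?thesis
    unfolding t' t_def[symmetric] J_def[symmetric] S_def[symmetric] by blast
qed

theorem lemma4p1:
  fixes r s l :: nat and A :: "nat \<Rightarrow> real mat" and b :: "nat \<Rightarrow> real vec" and M :: real
  assumes "1 \<le> r" and "1 \<le> s" and "1 \<le> l" and "0 < M"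
    and "\<forall>k\<in>{1..r}. A k \<in> carrier_mat s s \<and> b k \<in> carrier_vec s"
  shows "\<exists>C::real. \<forall>(m::nat) (nrm :: real vec \<Rightarrow> real) (h::real)
      (L :: nat \<Rightarrow> real mat) (Z :: nat \<Rightarrow> real mat) (g :: nat \<Rightarrow> real \<Rightarrow> real vec)
      (T :: real set) (u :: real \<Rightarrow> real vec) (\<phi> :: nat \<Rightarrow> nat \<Rightarrow> real \<Rightarrow> real vec)
      (N::nat) (U :: nat \<Rightarrow> real vec) (V :: nat \<Rightarrow> nat \<Rightarrow> real vec) (\<epsilon> :: nat \<Rightarrow> real vec).
      1 \<le> m \<longrightarrow> is_vec_norm m nrm \<longrightarrow> 0 < h \<longrightarrow>
      (\<forall>k\<in>{1..r}. L k \<in> carrier_mat m m) \<longrightarrow>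
      (\<forall>k\<in>{1..r}. Z k = h \<cdot>\<^sub>m L k) \<longrightarrow>
      0 \<in> T \<longrightarrow> (\<forall>x\<in>T. \<forall>y\<in>T. {x..y} \<subseteq> T) \<longrightarrow>
      (\<forall>n<N. step_times r s A h n \<subseteq> T) \<longrightarrow>
      (\<forall>k\<in>{1..r}. \<forall>t\<in>T. g k t \<in> carrier_vec m) \<longrightarrow>
      (\<forall>t\<in>T. u t \<in> carrier_vec m) \<longrightarrow>
      (\<forall>t\<in>T. has_vec_deriv m u
         (msum m m L {1..r} *\<^sub>v u t + vsum m (\<lambda>k. g k t) {1..r}) (at t within T)) \<longrightarrow>
      (\<forall>k\<in>{1..r}. C_with_derivs m l T (\<lambda>t. split_rhs L g k t (u t)) (\<phi> k)) \<longrightarrow>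
      invertible_mat (stage_matrix m r s A Z) \<longrightarrow>
      (\<forall>j<s. induced_norm m nrm (r_block m r s A b Z j) \<le> M) \<longrightarrow>
      U 0 = u 0 \<longrightarrow>
      (\<forall>n<N. prk_step m r s A b (split_rhs L g) h (real n * h) (U n) (V n) (U (Suc n))) \<longrightarrow>
      (\<forall>n\<le>N. \<epsilon> n = u (real n * h) - U n) \<longrightarrow>
      (\<exists>\<delta> \<rho> :: nat \<Rightarrow> real vec. \<forall>n<N.
         \<delta> n \<in> carrier_vec m \<and> \<rho> n \<in> carrier_vec m \<and>
         \<epsilon> (Suc n) = R_mat m r s A b Z *\<^sub>v \<epsilon> n + \<delta> n \<and>
         \<delta> n = vsum m (\<lambda>j. (h ^ j / fact j) \<cdot>\<^sub>v
                   vsum m (\<lambda>k. d_coeff m r s A b Z j k *\<^sub>v \<phi> k (j - 1) (real n * h)) {1..r}) {1..l}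
               + \<rho> n \<and>
         nrm (\<rho> n) \<le> C * h ^ (l + 1) *
           Sup {nrm (\<phi> k l t) | k t. k \<in> {1..r} \<and> t \<in> step_interval r s A h n})"
\<comment> \<open>The witness is chosen before \<open>m\<close>, the norm, \<open>h\<close> and the
  system. Its first summand bounds the update remainder; in the second, \<open>M\<close> bounds the
  block of \<open>rT\<close> that multiplies the remainder of each stage.\<close>
proof (rule exI[of _ "defect_const r s l (\<lambda>i. abscissae r s A $ i) (\<lambda>k q. b k $ q) 1 +
    M * (\<Sum>i<s. defect_const r s l (\<lambda>i. abscissae r s A $ i) (\<lambda>k q. A k $$ (i, q)) (abscissae r s A $ i))"],
    intro allI impI, goal_cases)
  case prems: (1 m nrm h L Z g T u \<phi> N U V \<epsilon>)
  \<comment> \<open>The one-step result provides \<open>\<delta>\<close> and \<open>\<rho>\<close>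
    for each \<open>n\<close> separately; choice makes sequences of them.\<close>
  have choice2: "\<exists>\<delta> \<rho>. \<forall>n<N. Q n (\<delta> n) (\<rho> n)" if "\<And>n. n < N \<Longrightarrow> \<exists>\<delta> \<rho>. Q n \<delta> \<rho>"
    for Q :: "nat \<Rightarrow> real vec \<Rightarrow> real vec \<Rightarrow> bool"
    using that by metis
  show ?case
  proof (rule choice2, goal_cases)
    case n: (1 n)
    have \<epsilon>: "\<epsilon> n = u (real n * h) - U n" "\<epsilon> (Suc n) = u (real (Suc n) * h) - U (Suc n)"
      using prems(17) n by auto
    show ?case
      unfolding \<epsilon>
      by (rule prk_local_error[OF prems(2,3) assms(4,5) prems(4,5,7) prems(8)[rule_format, OF n]
            prems(9-14) prems(16)[rule_format, OF n]])
  qed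
qed

end
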